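(* Let $n\ge 2$. For every nonzero $f\in\mathbb{R}[x_1,\dots,x_n]$ there exists a semi-algebraic set $S\subset\mathbb{R}^n$ such that $\dim(\mathbb{R}^n\setminus S)<n$ and for all $(c_1,\dots,c_n)\in S$ the mapping $g:\mathbb{R}^n\to\mathbb{R}$ defined by $$g=\frac{f^2}{\bigl((x_1-c_1)^2+\dots+(x_n-c_n)^2+1\bigr)^{\deg(f)+1}}$$ is a routing function.
   Context: $\|\cdot\|$ is the Euclidean norm. For a $C^2$ function $g:\mathbb{R}^n\to\mathbb{R}$, a routing point of $g$ is a critical point $p$ of $g$ with $g(p)\neq0$. A $C^2$ function $g$ is a routing function if: (i) $g(x)\ge0$ for all $x$; (ii) for all $\varepsilon>0$ there is $\delta>0$ such that $\|x\|\ge\delta$ implies $g(x)\le\varepsilon$; (iii) the set of routing points is finite; (iv) every routing point is nondegenerate, i.e. the Hessian of $g$ is non-singular there; (v) the norms of the first and second derivatives of $g$ are bounded. The symbol $\subset$ does not exclude equality, and the empty set has dimension less than $n$. *)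

theory Defs
  imports "HOL-Analysis.Analysis" "HOL-Library.Poly_Mapping"
begin

text \<open>The ring \<open>\<real>[x\<^sub>i | i \<in> 'i]\<close>: an exponent vector is mapped to its coefficient.\<close>

type_synonym 'i mpoly = "('i \<Rightarrow>\<^sub>0 nat) \<Rightarrow>\<^sub>0 real"

definition eval_mpoly :: "('i::finite) mpoly \<Rightarrow> real ^ 'i \<Rightarrow> real" where
  "eval_mpoly p x =
     (\<Sum>m\<in>Poly_Mapping.keys p. Poly_Mapping.lookup p m * (\<Prod>i\<in>UNIV. (x $ i) ^ Poly_Mapping.lookup m i))"

text \<open>The inserted \<open>0\<close> only matters for the zero polynomial.\<close>

definition total_degree :: "('i::finite) mpoly \<Rightarrow> nat" where
  "total_degree p =
     Max (insert 0 ((\<lambda>m. \<Sum>i\<in>UNIV. Poly_Mapping.lookup m i) ` Poly_Mapping.keys p))"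

text \<open>Boolean combinations of polynomial inequalities. Equations are included, since
  \<open>p = 0\<close> is the complement of \<open>p\<^sup>2 > 0\<close>.\<close>

inductive semialgebraic :: "(real ^ 'i::finite) set \<Rightarrow> bool" where
  pos: "semialgebraic {x. 0 < eval_mpoly p x}"
| union: "semialgebraic A \<Longrightarrow> semialgebraic B \<Longrightarrow> semialgebraic (A \<union> B)"
| inter: "semialgebraic A \<Longrightarrow> semialgebraic B \<Longrightarrow> semialgebraic (A \<inter> B)"
| compl: "semialgebraic A \<Longrightarrow> semialgebraic (- A)"

definition vec_append :: "real ^ 'n \<Rightarrow> real ^ 'm \<Rightarrow> real ^ ('n::finite + 'm::finite)" where
  "vec_append x y = (\<chi> k. case k of Inl i \<Rightarrow> x $ i | Inr j \<Rightarrow> y $ j)"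

definition semialgebraic_map_on :: "(real ^ 'n::finite) set \<Rightarrow> (real ^ 'n \<Rightarrow> real ^ 'm::finite) \<Rightarrow> bool"
  where
  "semialgebraic_map_on A h \<longleftrightarrow> semialgebraic ((\<lambda>x. vec_append x (h x)) ` A)"

definition semialg_homeomorphic :: "(real ^ 'n::finite) set \<Rightarrow> (real ^ 'm::finite) set \<Rightarrow> bool" where
  "semialg_homeomorphic A B \<longleftrightarrow>
     (\<exists>h k. homeomorphism A B h k \<and> semialgebraic_map_on A h \<and> semialgebraic_map_on B k)"

text \<open>The cube \<open>(0,1)\<^sup>d\<close>, \<open>d = card D\<close>, placed in the coordinate subspace of \<open>\<real>\<^sup>n\<close> given by \<open>D\<close>.\<close>

definition open_cube :: "'n set \<Rightarrow> (real ^ 'n::finite) set" where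
  "open_cube D = {x. (\<forall>i\<in>D. 0 < x $ i \<and> x $ i < 1) \<and> (\<forall>i. i \<notin> D \<longrightarrow> x $ i = 0)}"

text \<open>The dimension of a semi-algebraic set is the largest dimension of a cell contained in it,
  a cell of dimension \<open>d\<close> being a set semi-algebraically homeomorphic to \<open>(0,1)\<^sup>d\<close>.
  A subset of \<open>\<real>\<^sup>n\<close> contains no cell of dimension greater than \<open>n\<close>, so the cubes
  \<open>open_cube D\<close> represent all cases. The empty set has dimension \<open>-1\<close>.\<close>

definition semialg_dim :: "(real ^ 'n::finite) set \<Rightarrow> int" where
  "semialg_dim A =
     Max (insert (- 1) {int (card D) | D C. C \<subseteq> A \<and> semialg_homeomorphic (open_cube (D :: 'n set)) C})"

definition gradient :: "(real ^ 'n \<Rightarrow> real) \<Rightarrow> real ^ 'n \<Rightarrow> real ^ 'n::finite" where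
  "gradient g x = (\<chi> i. frechet_derivative g (at x) (axis i 1))"

text \<open>The Hessian is the Jacobian matrix of the gradient.\<close>

definition hessian :: "(real ^ 'n \<Rightarrow> real) \<Rightarrow> real ^ 'n \<Rightarrow> real ^ 'n ^ 'n::finite" where
  "hessian g x = matrix (frechet_derivative (gradient g) (at x))"

definition C2 :: "(real ^ 'n::finite \<Rightarrow> real) \<Rightarrow> bool" where
  "C2 g \<longleftrightarrow>
     (\<forall>x. g differentiable (at x)) \<and>
     (\<forall>x. gradient g differentiable (at x)) \<and>
     continuous_on UNIV (hessian g)"

definition routing_point :: "(real ^ 'n::finite \<Rightarrow> real) \<Rightarrow> real ^ 'n \<Rightarrow> bool" where
  "routing_point g p \<longleftrightarrow> gradient g p = 0 \<and> g p \<noteq> 0"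

definition routing_function :: "(real ^ 'n::finite \<Rightarrow> real) \<Rightarrow> bool" where
  "routing_function g \<longleftrightarrow>
     C2 g \<and>
     (\<forall>x. g x \<ge> 0) \<and>
     (\<forall>\<epsilon>>0. \<exists>\<delta>>0. \<forall>x. norm x \<ge> \<delta> \<longrightarrow> g x \<le> \<epsilon>) \<and>
     finite {p. routing_point g p} \<and>
     (\<forall>p. routing_point g p \<longrightarrow> invertible (hessian g p)) \<and>
     bounded (range (gradient g)) \<and>
     bounded (range (hessian g))"

end

theory Submission
  imports Defs
begin

text \<open>Put \<open>k = deg f + 1\<close>. Where \<open>f\<close> does not vanish, \<open>x\<close> is critical for the parameter \<open>c\<close> iff
  \<open>c = x - w f'(x)\<close> for a root \<open>w\<close> of \<open>\<bar>f'(x)\<bar>\<^sup>2 w\<^sup>2 - k f(x) w + 1\<close>, so the pairs \<open>(x, w)\<close> form a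
  hypersurface \<open>W\<close> of dimension \<open>n\<close> with a polynomial map to the parameter space. Hence on \<open>W\<close> every
  coordinate \<open>x\<^sub>i\<close> is annihilated by some \<open>R\<^sub>i(c, t) \<noteq> 0\<close>, and taking its degree in \<open>t\<close> minimal makes
  it coprime to its \<open>t\<close>-derivative over the rational functions in \<open>c\<close>. Outside the zero set of a
  polynomial \<open>D\<^sub>i\<close> in \<open>c\<close>, therefore, \<open>R\<^sub>i(c, \<cdot>)\<close> has finitely many roots, all simple. The former
  bounds the number of routing points. If the Hessian kills a direction \<open>\<omega>\<close> at a routing point,
  differentiating \<open>R\<^sub>i\<close> along \<open>\<omega>\<close> gives \<open>\<omega>\<^sub>i \<partial>\<^sub>tR\<^sub>i(c, x\<^sub>i) = 0\<close>, hence \<open>\<omega> = 0\<close>. The set \<open>S\<close> is the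
  complement of a real hypersurface, so neither quantifier elimination nor Sard's theorem is needed.\<close>

section \<open>Algebraic dependence by counting monomials\<close>

text \<open>Two obstacles shape the argument. The relation R_i vanishes only over W, while a
  direction \<omega> in the kernel of the Hessian merely says that the line x + s \<omega>, with c
  kept fixed, satisfies the critical equation up to o(s). The line is kept and w is corrected to an
  exact root of the quadratic; then c has to move with s, but its velocity at s = 0 is zero. The
  correction needs a simple root w. Parameters c with a double root are images of points where the
  discriminant of the quadratic vanishes, so one more polynomial in c excludes them, provided that
  the discriminant is not identically zero; it is not, because f' has smaller degree than f. The
  other obstacle: counting monomials treats polynomial maps on a whole space, whereas W is only a
  hypersurface in a space of dimension n + 1. Its equation is therefore adjoined to the map as an
  additional coordinate, and the relation obtained is restricted to the value 0 of that
  coordinate.\<close>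

lemma homogeneous_system_nontrivial:
  fixes M :: "'x \<Rightarrow> 'y \<Rightarrow> real"
  assumes "finite Y" "finite X" "card Y < card X"
  shows "\<exists>a. (\<exists>x\<in>X. a x \<noteq> 0) \<and> (\<forall>y\<in>Y. (\<Sum>x\<in>X. a x * M x y) = 0)"
  using assms
proof (induction Y arbitrary: X M rule: finite_induct)
  case empty
  then obtain x where "x \<in> X"
    by (metis card_0_eq ex_in_conv less_irrefl card.empty)
  then show ?case by (intro exI[of _ "\<lambda>_. 1"]) auto
next
  case (insert y Y)
  show ?case
  proof (cases "\<forall>x\<in>X. M x y = 0")
    case True
    have "card Y < card X"
      using insert by simp
    then obtain a where "\<exists>x\<in>X. a x \<noteq> 0" "\<forall>y\<in>Y. (\<Sum>x\<in>X. a x * M x y) = 0"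
      using insert.IH[OF insert.prems(1)] by blast
    then show ?thesis
      using True by (intro exI[of _ a]) (auto intro!: sum.neutral)
  next
    case False
    \<comment> \<open>Gaussian elimination with pivot \<open>x0\<close>: solving equation
      \<open>y\<close> for the unknown at \<open>x0\<close> (the value \<open>a0\<close> below)
      removes one unknown and one equation.\<close>
    then obtain x0 where x0: "x0 \<in> X" "M x0 y \<noteq> 0" by blast
    define X' where "X' = X - {x0}"
    have X: "X = insert x0 X'" "x0 \<notin> X'" "finite X'"
      using x0 insert.prems by (auto simp: X'_def)
    have "card Y < card X'"
      using insert.prems insert.hyps X by simp
    then obtain a where a: "\<exists>x\<in>X'. a x \<noteq> 0"
      "\<forall>z\<in>Y. (\<Sum>x\<in>X'. a x * (M x z - M x y / M x0 y * M x0 z)) = 0"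
      using insert.IH[of X' "\<lambda>x z. M x z - M x y / M x0 y * M x0 z"] X(3) by blast
    define a0 where "a0 = - (\<Sum>x\<in>X'. a x * M x y / M x0 y)"
    have *: "(\<Sum>x\<in>X. (a(x0 := a0)) x * M x z) =
        (\<Sum>x\<in>X'. a x * (M x z - M x y / M x0 y * M x0 z))" for z
    proof -
      have "(\<Sum>x\<in>X. (a(x0 := a0)) x * M x z) = a0 * M x0 z + (\<Sum>x\<in>X'. a x * M x z)"
      proof -
        have "(\<Sum>x\<in>X'. (a(x0 := a0)) x * M x z) = (\<Sum>x\<in>X'. a x * M x z)"
          using X by (intro sum.cong) auto
        then show ?thesis using X by simp
      qed
      also have "a0 * M x0 z = (\<Sum>x\<in>X'. - (a x * M x y / M x0 y * M x0 z))"
        by (simp add: a0_def sum_distrib_right sum_negf)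
      also have "(\<Sum>x\<in>X'. - (a x * M x y / M x0 y * M x0 z)) + (\<Sum>x\<in>X'. a x * M x z) =
          (\<Sum>x\<in>X'. a x * (M x z - M x y / M x0 y * M x0 z))"
        unfolding sum.distrib[symmetric] by (intro sum.cong refl) (simp add: right_diff_distrib)
      finally show ?thesis .
    qed
    show ?thesis
    proof (intro exI[of _ "a(x0 := a0)"] conjI ballI)
      show "\<exists>x\<in>X. (a(x0 := a0)) x \<noteq> 0"
        using a(1) X by (metis fun_upd_other insertCI)
      fix z assume "z \<in> insert y Y"
      then show "(\<Sum>x\<in>X. (a(x0 := a0)) x * M x z) = 0"
        unfolding * using a(2) x0(2) by auto
    qed
  qed
qed

text \<open>With one variable singled out, the sum is a one-variable polynomial that vanishes
  everywhere, so each coefficient vanishes; the coefficients are sums of the same kind in the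
  remaining variables.\<close>

lemma monomials_independent:
  fixes a :: "('i \<Rightarrow> nat) \<Rightarrow> real"
  assumes "finite I"
    and "\<And>y. (\<Sum>m\<in>PiE I (\<lambda>_. {..D}). a m * (\<Prod>i\<in>I. y i ^ m i)) = 0"
    and "m \<in> PiE I (\<lambda>_. {..D})"
  shows "a m = 0"
  using assms
proof (induction I arbitrary: a m rule: finite_induct)
  case empty
  then show ?case by simp
next
  case (insert j I)
  let ?B = "PiE I (\<lambda>_. {..D})"
  have inj: "inj_on (\<lambda>(k, m). m(j := k)) ({..D} \<times> ?B)"
    using inj_combinator[OF insert.hyps(2), of "\<lambda>_. {..D}"] .
  have split: "(\<Sum>m\<in>PiE (insert j I) (\<lambda>_. {..D}). a m * (\<Prod>i\<in>insert j I. y i ^ m i)) =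
     (\<Sum>k\<le>D. (\<Sum>m\<in>?B. a (m(j := k)) * (\<Prod>i\<in>I. y i ^ m i)) * y j ^ k)" for y
  proof -
    have "(\<Sum>m\<in>PiE (insert j I) (\<lambda>_. {..D}). a m * (\<Prod>i\<in>insert j I. y i ^ m i)) =
      (\<Sum>(k, m)\<in>{..D} \<times> ?B. a (m(j := k)) * (\<Prod>i\<in>insert j I. y i ^ (m(j := k)) i))"
      unfolding PiE_insert_eq by (subst sum.reindex[OF inj]) (simp add: case_prod_unfold)
    also have "\<dots> = (\<Sum>k\<le>D. \<Sum>m\<in>?B. a (m(j := k)) * (\<Prod>i\<in>insert j I. y i ^ (m(j := k)) i))"
      by (simp add: sum.cartesian_product)
    also have "\<dots> = (\<Sum>k\<le>D. (\<Sum>m\<in>?B. a (m(j := k)) * (\<Prod>i\<in>I. y i ^ m i)) * y j ^ k)"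
    proof (intro sum.cong refl, unfold sum_distrib_right, intro sum.cong refl)
      fix k m
      have "(\<Prod>i\<in>insert j I. y i ^ (m(j := k)) i) = y j ^ k * (\<Prod>i\<in>I. y i ^ (m(j := k)) i)"
        using insert.hyps by simp
      also have "(\<Prod>i\<in>I. y i ^ (m(j := k)) i) = (\<Prod>i\<in>I. y i ^ m i)"
        using insert.hyps by (intro prod.cong) auto
      finally show "a (m(j := k)) * (\<Prod>i\<in>insert j I. y i ^ (m(j := k)) i) =
          a (m(j := k)) * (\<Prod>i\<in>I. y i ^ m i) * y j ^ k"
        by (simp add: algebra_simps)
    qed
    finally show ?thesis .
  qed
  have zero: "(\<Sum>m\<in>?B. a (m(j := k)) * (\<Prod>i\<in>I. y i ^ m i)) = 0" if "k \<le> D" for k y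
  proof -
    have "(\<Sum>k\<le>D. (\<Sum>m\<in>?B. a (m(j := k)) * (\<Prod>i\<in>I. y i ^ m i)) * t ^ k) = 0" for t
    proof -
      have "(\<Prod>i\<in>I. (y(j := t)) i ^ m i) = (\<Prod>i\<in>I. y i ^ m i)" for m
        using insert.hyps by (intro prod.cong) auto
      then show ?thesis
        using split[of "y(j := t)"] insert.prems(1)[of "y(j := t)"] by simp
    qed
    then show ?thesis
      using polyfun_eq_0[of "\<lambda>k. \<Sum>m\<in>?B. a (m(j := k)) * (\<Prod>i\<in>I. y i ^ m i)" D] that by blast
  qed
  from insert.prems(2) obtain k m' where m: "m = m'(j := k)" "k \<le> D" "m' \<in> ?B"
    unfolding PiE_insert_eq by auto
  show ?case
    unfolding m(1) using insert.IH[of "\<lambda>m. a (m(j := k))" m'] zero[OF m(2)] m(3) by blast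
qed

text \<open>Refines \<open>real_polynomial_function\<close> by an upper bound for the degree, needed
  for counting monomials and for growth at infinity. The slack in \<open>const\<close>,
  \<open>linear\<close> and \<open>mult\<close> makes the bound monotone.\<close>

inductive poly_degree_le :: "nat \<Rightarrow> ('a::real_normed_vector \<Rightarrow> real) \<Rightarrow> bool" where
  const: "poly_degree_le k (\<lambda>x. c)"
| linear: "bounded_linear l \<Longrightarrow> poly_degree_le (Suc k) l"
| add: "poly_degree_le k p \<Longrightarrow> poly_degree_le k q \<Longrightarrow> poly_degree_le k (\<lambda>x. p x + q x)"
| mult: "poly_degree_le j p \<Longrightarrow> poly_degree_le k q \<Longrightarrow> j + k \<le> l \<Longrightarrow> poly_degree_le l (\<lambda>x. p x * q x)"

lemma poly_degree_le_mono: "poly_degree_le k p \<Longrightarrow> k \<le> k' \<Longrightarrow> poly_degree_le k' p"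
  using poly_degree_le.mult[of 0 "\<lambda>_. 1" k p k'] poly_degree_le.const[of 0 1] by simp

lemma poly_degree_le_imp_real_polynomial_function:
  "poly_degree_le k p \<Longrightarrow> real_polynomial_function p"
  by (induction rule: poly_degree_le.induct) auto

lemma real_polynomial_function_imp_poly_degree_le:
  "real_polynomial_function p \<Longrightarrow> \<exists>k. poly_degree_le k p"
proof (induction rule: real_polynomial_function.induct)
  case (add p q)
  then obtain j k where "poly_degree_le j p" "poly_degree_le k q" by blast
  then have "poly_degree_le (max j k) p" "poly_degree_le (max j k) q"
    by (auto elim: poly_degree_le_mono)
  then show ?case by (blast intro: poly_degree_le.add)
qed (blast intro: poly_degree_le.intros)+

lemma poly_degree_le_sum:
  "(\<And>i. i \<in> I \<Longrightarrow> poly_degree_le k (p i)) \<Longrightarrow> poly_degree_le k (\<lambda>x. \<Sum>i\<in>I. p i x)"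
  by (induction I rule: infinite_finite_induct) (auto intro: poly_degree_le.intros)

lemma poly_degree_le_prod:
  "(\<And>i. i \<in> I \<Longrightarrow> poly_degree_le (k i) (p i)) \<Longrightarrow>
    poly_degree_le (\<Sum>i\<in>I. k i) (\<lambda>x. \<Prod>i\<in>I. p i x)"
proof (induction I rule: infinite_finite_induct)
  case (insert i I)
  then show ?case
    using poly_degree_le.mult[of "k i" "p i" "sum k I" "\<lambda>x. \<Prod>i\<in>I. p i x" "k i + sum k I"]
    by simp
qed (simp_all add: poly_degree_le.const)

lemma poly_degree_le_power:
  "poly_degree_le k p \<Longrightarrow> poly_degree_le (n * k) (\<lambda>x. p x ^ n)"
  by (induction n) (auto intro: poly_degree_le.intros)

text \<open>Each exponent is bounded separately, not their total: the index set is then a product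
  with (k + 1)^n elements, and the count below can afford the larger set.\<close>

definition box_monomial_sum :: "nat \<Rightarrow> ('a::euclidean_space \<Rightarrow> real) \<Rightarrow> bool" where
  "box_monomial_sum k h \<longleftrightarrow>
    (\<exists>a. \<forall>x. h x = (\<Sum>m\<in>PiE Basis (\<lambda>_. {..k}). a m * (\<Prod>i\<in>Basis. (x \<bullet> i) ^ m i)))"

lemma finite_exponent_box [simp]: "finite (PiE (Basis :: 'a::euclidean_space set) (\<lambda>_. {..k::nat}))"
  by (intro finite_PiE) auto

lemma box_monomial_sum_monomial:
  assumes "\<And>i. i \<in> Basis \<Longrightarrow> m i \<le> k"
  shows "box_monomial_sum k (\<lambda>x. c * (\<Prod>i\<in>Basis. (x \<bullet> i) ^ m i))"
proof -
  define m' where "m' = restrict m Basis"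
  have "m' \<in> PiE Basis (\<lambda>_. {..k})"
    using assms by (auto simp: m'_def)
  moreover have "(\<Prod>i\<in>Basis. (x \<bullet> i) ^ m i) = (\<Prod>i\<in>Basis. (x \<bullet> i) ^ m' i)" for x :: 'a
    by (intro prod.cong) (auto simp: m'_def)
  ultimately show ?thesis
    unfolding box_monomial_sum_def
    by (intro exI[of _ "\<lambda>l. if l = m' then c else 0"])
       (simp add: if_distrib[of "\<lambda>a. a * _"] sum.delta cong: if_cong)
qed

lemma box_monomial_sum_add:
  assumes "box_monomial_sum k p" "box_monomial_sum k q"
  shows "box_monomial_sum k (\<lambda>x. p x + q x)"
proof -
  obtain a b where
    "\<forall>x. p x = (\<Sum>m\<in>PiE Basis (\<lambda>_. {..k}). a m * (\<Prod>i\<in>Basis. (x \<bullet> i) ^ m i))"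
    "\<forall>x. q x = (\<Sum>m\<in>PiE Basis (\<lambda>_. {..k}). b m * (\<Prod>i\<in>Basis. (x \<bullet> i) ^ m i))"
    using assms unfolding box_monomial_sum_def by blast
  then show ?thesis
    unfolding box_monomial_sum_def
    by (intro exI[of _ "\<lambda>m. a m + b m"]) (simp add: sum.distrib algebra_simps)
qed

lemma box_monomial_sum_sum:
  "(\<And>i. i \<in> I \<Longrightarrow> box_monomial_sum k (p i)) \<Longrightarrow> box_monomial_sum k (\<lambda>x. \<Sum>i\<in>I. p i x)"
proof (induction I rule: infinite_finite_induct)
  case empty
  show ?case using box_monomial_sum_monomial[of "\<lambda>_. 0" k 0] by simp
next
  case (infinite I)
  show ?case using infinite box_monomial_sum_monomial[of "\<lambda>_. 0" k 0] by simp
qed (auto intro: box_monomial_sum_add)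

lemma poly_degree_le_imp_box_monomial_sum:
  fixes p :: "'a::euclidean_space \<Rightarrow> real"
  assumes "poly_degree_le k p"
  shows "box_monomial_sum k p"
  using assms
proof (induction rule: poly_degree_le.induct)
  case (const k c)
  show ?case using box_monomial_sum_monomial[of "\<lambda>_. 0" k c] by simp
next
  case (linear l k)
  note lin = bounded_linear.linear[OF linear]
  have *: "l x = (\<Sum>b\<in>Basis. l b * (\<Prod>i\<in>Basis. (x \<bullet> i) ^ (if i = b then 1 else 0)))" for x
  proof -
    have "l x = l (\<Sum>b\<in>Basis. (x \<bullet> b) *\<^sub>R b)"
      by (simp add: euclidean_representation)
    also have "\<dots> = (\<Sum>b\<in>Basis. (x \<bullet> b) * l b)"
      by (simp add: linear_sum[OF lin] linear_cmul[OF lin])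
    also have "\<dots> = (\<Sum>b\<in>Basis. l b * (\<Prod>i\<in>Basis. (x \<bullet> i) ^ (if i = b then 1 else 0)))"
    proof (intro sum.cong refl)
      fix b :: 'a assume "b \<in> Basis"
      then have "(\<Prod>i\<in>Basis. (x \<bullet> i) ^ (if i = b then 1 else 0)) = x \<bullet> b"
        by (simp add: if_distrib prod.delta cong: if_cong)
      then show "(x \<bullet> b) * l b = l b * (\<Prod>i\<in>Basis. (x \<bullet> i) ^ (if i = b then 1 else 0))"
        by simp
    qed
    finally show ?thesis .
  qed
  have "box_monomial_sum (Suc k)
      (\<lambda>x. \<Sum>b\<in>Basis. l b * (\<Prod>i\<in>Basis. (x \<bullet> i) ^ (if i = b then 1 else 0)))"
    by (intro box_monomial_sum_sum box_monomial_sum_monomial) auto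
  then show ?case
    by (simp only: *[symmetric])
next
  case (add k p q)
  then show ?case by (blast intro: box_monomial_sum_add)
next
  case (mult j p k q l)
  obtain a b where
    p: "\<forall>x. p x = (\<Sum>m\<in>PiE Basis (\<lambda>_. {..j}). a m * (\<Prod>i\<in>Basis. (x \<bullet> i) ^ m i))" and
    q: "\<forall>x. q x = (\<Sum>m\<in>PiE Basis (\<lambda>_. {..k}). b m * (\<Prod>i\<in>Basis. (x \<bullet> i) ^ m i))"
    using mult.IH unfolding box_monomial_sum_def by blast
  have *: "p x * q x = (\<Sum>m\<in>PiE Basis (\<lambda>_. {..j}). \<Sum>m'\<in>PiE Basis (\<lambda>_. {..k}).
      (a m * b m') * (\<Prod>i\<in>Basis. (x \<bullet> i) ^ (m i + m' i)))" for x
    unfolding p[rule_format] q[rule_format]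
    by (simp add: sum_product power_add prod.distrib algebra_simps)
  have "box_monomial_sum l (\<lambda>x. \<Sum>m\<in>PiE Basis (\<lambda>_. {..j}). \<Sum>m'\<in>PiE Basis (\<lambda>_. {..k}).
      (a m * b m') * (\<Prod>i\<in>Basis. (x \<bullet> i) ^ (m i + m' i)))"
  proof (intro box_monomial_sum_sum box_monomial_sum_monomial)
    fix m m' :: "'a \<Rightarrow> nat" and i :: 'a
    assume "m \<in> PiE Basis (\<lambda>_. {..j})" "m' \<in> PiE Basis (\<lambda>_. {..k})" "i \<in> Basis"
    then have "m i \<le> j" "m' i \<le> k" by auto
    then show "m i + m' i \<le> l" using mult.hyps by linarith
  qed
  then show ?case
    by (simp only: *[symmetric])
qed

text \<open>Of the \<open>(D + 1)\<^sup>M\<close> monomials in the \<open>M\<close> functions \<open>u\<^sub>j\<close>, homogenised by powers of \<open>v\<close>,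
  all lie in a space of dimension \<open>O(D\<^sup>N)\<close> with \<open>N < M\<close>.\<close>

lemma polynomials_algebraically_dependent:
  fixes u :: "'a::euclidean_space \<Rightarrow> 'b::euclidean_space" and v :: "'a \<Rightarrow> real"
  assumes u: "polynomial_function u" and v: "real_polynomial_function v"
    and dim: "DIM('a) < DIM('b)"
  shows "\<exists>Q. real_polynomial_function Q \<and> (\<exists>y. Q y \<noteq> 0) \<and>
    (\<forall>x. v x \<noteq> 0 \<longrightarrow> Q (u x /\<^sub>R v x) = 0)"
proof -
  have "\<forall>j\<in>Basis. \<exists>k. poly_degree_le k (\<lambda>x. u x \<bullet> j)"
    using u by (auto simp: polynomial_function_iff_Basis_inner
        intro: real_polynomial_function_imp_poly_degree_le)
  then obtain ku where ku: "\<And>j. j \<in> Basis \<Longrightarrow> poly_degree_le (ku j) (\<lambda>x. u x \<bullet> j)"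
    by metis
  obtain kv where kv: "poly_degree_le kv v"
    using real_polynomial_function_imp_poly_degree_le[OF v] by blast
  \<comment> \<open>A common degree bound for \<open>v\<close> and all coordinates of
    \<open>u\<close>; \<open>Suc\<close> makes it positive, so that \<open>M * e \<ge> 1\<close> in
    the count.\<close>
  define e where "e = Suc (kv + (\<Sum>j\<in>Basis. ku j))"
  have ue: "poly_degree_le e (\<lambda>x. u x \<bullet> j)" if "j \<in> Basis" for j
    by (rule poly_degree_le_mono[OF ku[OF that]])
       (use that in \<open>auto simp: e_def intro!: le_SucI trans_le_add2 member_le_sum\<close>)
  have ve: "poly_degree_le e v"
    by (rule poly_degree_le_mono[OF kv]) (simp add: e_def)
  define M where "M = DIM('b)"
  \<comment> \<open>Chosen for the count: with N = \<open>DIM('a)\<close>, (M e D + 1)^N \<le> (M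
    e)^N (D + 1)^N = D (D + 1)^N, which is less than (D + 1)^(N + 1).\<close>
  define D where "D = (M * e) ^ DIM('a)"
  define X where "X = PiE (Basis :: 'b set) (\<lambda>_. {..D})"
  define L where "L = M * D * e"
  define Y where "Y = PiE (Basis :: 'a set) (\<lambda>_. {..L})"
  \<comment> \<open>Where \<open>v\<close> is nonzero this is \<open>v x ^ (M * D)\<close> times the
    monomial \<open>m\<close> at \<open>u x /\<^sub>R v x\<close>. The factor is the same for all
    \<open>m\<close>, so a linear relation between the \<open>h m\<close> is a relation between the
    monomials.\<close>
  define h where "h m x = (\<Prod>j\<in>Basis. (u x \<bullet> j) ^ m j * v x ^ (D - m j))" for m x
  have fin: "finite X" "finite Y"
    unfolding X_def Y_def by simp_all
  have "box_monomial_sum L (h m)" if "m \<in> X" for m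
  proof -
    have "poly_degree_le (\<Sum>j\<in>(Basis::'b set). D * e) (h m)"
      unfolding h_def
    proof (rule poly_degree_le_prod)
      fix j :: 'b assume j: "j \<in> Basis"
      then have "m j \<le> D" using that by (auto simp: X_def)
      then have "m j * e + (D - m j) * e \<le> D * e"
        by (metis add_mult_distrib le_add_diff_inverse order_refl)
      then show "poly_degree_le (D * e) (\<lambda>x. (u x \<bullet> j) ^ m j * v x ^ (D - m j))"
        using poly_degree_le.mult[OF poly_degree_le_power[OF ue[OF j]] poly_degree_le_power[OF ve]]
        by blast
    qed
    moreover have "(\<Sum>j\<in>(Basis::'b set). D * e) = L"
      by (simp add: L_def M_def)
    ultimately show ?thesis
      using poly_degree_le_imp_box_monomial_sum by metis
  qed
  then obtain A where A: "\<And>m x. m \<in> X \<Longrightarrow>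
      h m x = (\<Sum>l\<in>Y. A m l * (\<Prod>i\<in>Basis. (x \<bullet> i) ^ l i))"
    unfolding box_monomial_sum_def Y_def by metis
  have "card Y < card X"
  proof -
    have "M \<ge> 1" "e \<ge> 1"
      using dim by (auto simp: M_def e_def)
    then have Me: "M * e \<ge> 1" by simp
    have "card Y = (L + 1) ^ DIM('a)"
      by (simp add: Y_def card_PiE)
    also have "\<dots> \<le> (M * e * (D + 1)) ^ DIM('a)"
      using Me by (intro power_mono) (auto simp: L_def algebra_simps)
    also have "\<dots> = D * (D + 1) ^ DIM('a)"
      unfolding power_mult_distrib[of "M * e" "D + 1"] by (simp only: D_def)
    also have "\<dots> < (D + 1) * (D + 1) ^ DIM('a)"
      by simp
    also have "\<dots> = (D + 1) ^ Suc (DIM('a))" by simp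
    also have "\<dots> \<le> (D + 1) ^ M"
      using dim by (intro power_increasing) (auto simp: M_def)
    also have "\<dots> = card X"
      by (simp add: X_def card_PiE M_def)
    finally show ?thesis .
  qed
  then obtain a where a: "\<exists>m\<in>X. a m \<noteq> 0" "\<forall>l\<in>Y. (\<Sum>m\<in>X. a m * A m l) = 0"
    using homogeneous_system_nontrivial[OF fin(2,1), of A] by blast
  define Q where "Q y = (\<Sum>m\<in>X. a m * (\<Prod>j\<in>Basis. (y \<bullet> j) ^ m j))" for y :: 'b
  show ?thesis
  proof (intro exI[of _ Q] conjI allI impI)
    show "real_polynomial_function Q"
      unfolding Q_def using fin
      by (intro real_polynomial_function_sum real_polynomial_function.intros
          real_polynomial_function_prod real_polynomial_function_power
          bounded_linear_inner_left) auto
    show "\<exists>y. Q y \<noteq> 0"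
    proof (rule ccontr)
      assume "\<not> ?thesis"
      then have Q0: "Q y = 0" for y by blast
      have "(\<Sum>m\<in>X. a m * (\<Prod>j\<in>Basis. y j ^ m j)) = 0" for y :: "'b \<Rightarrow> real"
      proof -
        have "(\<Prod>j\<in>Basis. y j ^ m j) = (\<Prod>j\<in>Basis. ((\<Sum>b\<in>Basis. y b *\<^sub>R b) \<bullet> j) ^ m j)" for m
          by (intro prod.cong refl) (simp add: inner_sum_left_Basis)
        then show ?thesis
          using Q0[of "\<Sum>b\<in>Basis. y b *\<^sub>R b"] by (simp add: Q_def)
      qed
      then show False
        using monomials_independent[where I = "Basis :: 'b set" and a = a and D = D] a(1) unfolding X_def by auto
    qed
    fix x assume vx: "v x \<noteq> 0"
    have "v x ^ (M * D) * Q (u x /\<^sub>R v x) = (\<Sum>m\<in>X. a m * h m x)"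
      unfolding Q_def sum_distrib_left
    proof (intro sum.cong refl)
      fix m assume "m \<in> X"
      then have mD: "m j \<le> D" if "j \<in> Basis" for j
        using that by (auto simp: X_def)
      have "v x ^ (M * D) = (\<Prod>j\<in>(Basis::'b set). v x ^ D)"
        by (simp add: M_def power_mult[symmetric] mult.commute)
      then have "v x ^ (M * D) * (\<Prod>j\<in>Basis. ((u x /\<^sub>R v x) \<bullet> j) ^ m j) =
          (\<Prod>j\<in>Basis. v x ^ D * ((u x /\<^sub>R v x) \<bullet> j) ^ m j)"
        by (simp add: prod.distrib)
      also have "\<dots> = h m x"
        unfolding h_def
      proof (intro prod.cong refl)
        fix j :: 'b assume "j \<in> Basis"
        then have "v x ^ D = v x ^ m j * v x ^ (D - m j)"
          using mD by (simp flip: power_add)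
        then show "v x ^ D * ((u x /\<^sub>R v x) \<bullet> j) ^ m j = (u x \<bullet> j) ^ m j * v x ^ (D - m j)"
          using vx by (simp add: power_mult_distrib field_simps)
      qed
      finally show "v x ^ (M * D) * (a m * (\<Prod>j\<in>Basis. ((u x /\<^sub>R v x) \<bullet> j) ^ m j)) = a m * h m x"
        by (simp add: algebra_simps)
    qed
    also have "\<dots> = (\<Sum>m\<in>X. \<Sum>l\<in>Y. a m * (A m l * (\<Prod>i\<in>Basis. (x \<bullet> i) ^ l i)))"
      by (simp add: A sum_distrib_left)
    also have "\<dots> = (\<Sum>l\<in>Y. (\<Sum>m\<in>X. a m * A m l) * (\<Prod>i\<in>Basis. (x \<bullet> i) ^ l i))"
      by (subst sum.swap) (simp add: sum_distrib_right algebra_simps)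
    also have "\<dots> = 0"
      using a(2) by simp
    finally show "Q (u x /\<^sub>R v x) = 0"
      using vx by simp
  qed
qed

section \<open>Polynomial functions as an integral domain\<close>

text \<open>On a line, nonvanishing questions in several variables reduce to the finiteness of the
  roots of a nonzero polynomial in one variable.\<close>

lemma real_polynomial_function_along_line:
  assumes "real_polynomial_function p"
  obtains q :: "real poly" where "\<And>t. p (x + t *\<^sub>R v) = poly q t"
proof -
  have "polynomial_function (\<lambda>t::real. x + t *\<^sub>R v)"
    by (intro polynomial_function_add polynomial_function_mult polynomial_function_const
        polynomial_function_id)
  then have "real_polynomial_function (p \<circ> (\<lambda>t::real. x + t *\<^sub>R v))"
    using assms by (rule real_polynomial_function_compose)
  then obtain a n where "p \<circ> (\<lambda>t::real. x + t *\<^sub>R v) = (\<lambda>t. \<Sum>i\<le>n. a i * t ^ i)"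
    using real_polynomial_function_imp_sum by blast
  then have "p (x + t *\<^sub>R v) = poly (\<Sum>i\<le>n. monom (a i) i) t" for t
    by (simp add: o_def fun_eq_iff poly_sum poly_monom)
  then show thesis by (rule that)
qed

text \<open>On the line from \<open>x\<close> to \<open>y\<close> the first function is nonzero at
  parameter 0 and the second at parameter 1, so their product is a nonzero polynomial in the
  parameter. This is the absence of zero divisors for \<open>polyfun\<close>.\<close>

lemma real_polynomial_functions_common_nonzero:
  assumes "real_polynomial_function p" "real_polynomial_function q" "p x \<noteq> 0" "q y \<noteq> 0"
  shows "\<exists>z. p z \<noteq> 0 \<and> q z \<noteq> 0"
proof -
  obtain P Q where P: "\<And>t. p (x + t *\<^sub>R (y - x)) = poly P t"
    and Q: "\<And>t. q (x + t *\<^sub>R (y - x)) = poly Q t"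
    using real_polynomial_function_along_line assms(1,2) by metis
  have "P \<noteq> 0" "Q \<noteq> 0"
    using P[of 0] Q[of 1] assms(3,4) by auto
  then obtain t where "poly (P * Q) t \<noteq> 0"
    using poly_all_0_iff_0[of "P * Q"] by auto
  then show ?thesis
    using P Q by (intro exI[of _ "x + t *\<^sub>R (y - x)"]) simp
qed

text \<open>The line from \<open>x\<close> to \<open>y\<close> carries only finitely many zeros, so
  points of it close to \<open>x\<close> avoid them. Density of the nonvanishing set is used for
  continuity arguments and for the dimension of the complement of S.\<close>

lemma real_polynomial_function_nonzero_in_open:
  assumes "real_polynomial_function p" "p y \<noteq> 0" "open U" "x \<in> U"
  shows "\<exists>z\<in>U. p z \<noteq> 0"
proof -
  obtain P where P: "\<And>t. p (x + t *\<^sub>R (y - x)) = poly P t"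
    using real_polynomial_function_along_line assms(1) by metis
  have "P \<noteq> 0"
    using P[of 1] assms(2) by auto
  have "((\<lambda>t. x + t *\<^sub>R (y - x)) \<longlongrightarrow> x + 0 *\<^sub>R (y - x)) (at (0::real))"
    by (intro tendsto_intros)
  then have "\<forall>\<^sub>F t in at (0::real). x + t *\<^sub>R (y - x) \<in> U"
    using assms(3,4) by (intro topological_tendstoD[where f = "\<lambda>t. x + t *\<^sub>R (y - x)"]) auto
  moreover have "\<forall>\<^sub>F t in at 0. poly P t \<noteq> 0"
  proof -
    have "finite ({t. poly P t = 0} - {0})"
      using poly_roots_finite[OF \<open>P \<noteq> 0\<close>] by simp
    then have "open (- ({t. poly P t = 0} - {0}))"
      by (intro open_Compl finite_imp_closed)
    then show ?thesis
      unfolding eventually_at_topological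
      by (intro exI[of _ "- ({t. poly P t = 0} - {0})"]) auto
  qed
  ultimately have "\<forall>\<^sub>F t in at (0::real). x + t *\<^sub>R (y - x) \<in> U \<and> poly P t \<noteq> 0"
    by eventually_elim simp
  then have "\<exists>t. x + t *\<^sub>R (y - x) \<in> U \<and> poly P t \<noteq> 0"
    by (intro eventually_happens'[OF trivial_limit_at]) auto
  then show ?thesis using P by metis
qed

lemma nonzero_nearby:
  fixes g :: "'a::t2_space \<Rightarrow> 'b::t1_space"
  assumes "isCont g x" "g x \<noteq> y"
  shows "\<forall>\<^sub>F z in nhds x. g z \<noteq> y"
  using tendsto_imp_eventually_ne[OF assms(1)[unfolded isCont_def] assms(2)] assms(2)
  by (simp add: eventually_nhds_conv_at)

text \<open>As a type in class \<open>idom\<close>, polynomial functions can serve as coefficients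
  of \<open>poly\<close>, which gives access to degrees and pseudo-division.\<close>

typedef (overloaded) 'a polyfun = "{p :: 'a::real_normed_vector \<Rightarrow> real. real_polynomial_function p}"
  morphisms eval_polyfun Abs_polyfun
  by (rule exI[of _ "\<lambda>_. 0"]) auto

setup_lifting type_definition_polyfun

instantiation polyfun :: (real_normed_vector) idom
begin

lift_definition zero_polyfun :: "'a polyfun" is "\<lambda>_. 0" by auto
lift_definition one_polyfun :: "'a polyfun" is "\<lambda>_. 1" by auto
lift_definition plus_polyfun :: "'a polyfun \<Rightarrow> 'a polyfun \<Rightarrow> 'a polyfun"
  is "\<lambda>p q x. p x + q x" by auto
lift_definition minus_polyfun :: "'a polyfun \<Rightarrow> 'a polyfun \<Rightarrow> 'a polyfun"
  is "\<lambda>p q x. p x - q x" by auto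
lift_definition times_polyfun :: "'a polyfun \<Rightarrow> 'a polyfun \<Rightarrow> 'a polyfun"
  is "\<lambda>p q x. p x * q x" by auto
lift_definition uminus_polyfun :: "'a polyfun \<Rightarrow> 'a polyfun"
  is "\<lambda>p x. - p x" by auto

instance
proof
  fix a b :: "'a polyfun"
  assume "a \<noteq> 0" "b \<noteq> 0"
  then show "a * b \<noteq> 0"
    by transfer (force simp: fun_eq_iff dest: real_polynomial_functions_common_nonzero)
qed (transfer; force simp: fun_eq_iff algebra_simps)+

end

lemma real_polynomial_function_eval_polyfun [intro]: "real_polynomial_function (eval_polyfun p)"
  using eval_polyfun[of p] by simp

lemma eval_polyfun_simps [simp]:
  "eval_polyfun 0 c = 0" "eval_polyfun 1 c = 1"
  "eval_polyfun (p + q) c = eval_polyfun p c + eval_polyfun q c"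
  "eval_polyfun (p - q) c = eval_polyfun p c - eval_polyfun q c"
  "eval_polyfun (p * q) c = eval_polyfun p c * eval_polyfun q c"
  by (transfer; simp)+

lemma eval_polyfun_sum [simp]: "eval_polyfun (sum p I) c = (\<Sum>i\<in>I. eval_polyfun (p i) c)"
  by (induction I rule: infinite_finite_induct) auto

lemma eval_polyfun_prod [simp]: "eval_polyfun (prod p I) c = (\<Prod>i\<in>I. eval_polyfun (p i) c)"
  by (induction I rule: infinite_finite_induct) auto

lemma eval_polyfun_of_nat [simp]: "eval_polyfun (of_nat n) c = of_nat n"
  by (induction n) auto

lemma polyfun_nonzero_iff: "p \<noteq> 0 \<longleftrightarrow> (\<exists>c. eval_polyfun p c \<noteq> 0)"
  by transfer (simp add: fun_eq_iff)

text \<open>\<open>'a polyfun poly\<close> stands for the polynomials in one more variable.\<close>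

definition specialize :: "'a::real_normed_vector polyfun poly \<Rightarrow> 'a \<Rightarrow> real poly" where
  "specialize R c = map_poly (\<lambda>r. eval_polyfun r c) R"

lemma coeff_specialize [simp]: "coeff (specialize R c) n = eval_polyfun (coeff R n) c"
  by (simp add: specialize_def coeff_map_poly)

lemma specialize_simps [simp]:
  "specialize 0 c = 0"
  "specialize (pCons r R) c = pCons (eval_polyfun r c) (specialize R c)"
  "specialize (R + S) c = specialize R c + specialize S c"
  "specialize (smult r R) c = smult (eval_polyfun r c) (specialize R c)"
  "specialize (R * S) c = specialize R c * specialize S c"
  "specialize (pderiv R) c = pderiv (specialize R c)"
  by (auto intro!: poly_eqI simp: coeff_pCons coeff_mult coeff_pderiv split: nat.split)

lemma specialize_power [simp]: "specialize (R ^ n) c = specialize R c ^ n"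
  by (induction n) (auto simp: one_pCons)

lemma real_polynomial_function_specialize:
  "real_polynomial_function (\<lambda>z. poly (specialize R (fst z)) (snd z))"
proof (induction R)
  case 0
  then show ?case by auto
next
  case (pCons r R)
  have "real_polynomial_function (eval_polyfun r \<circ> fst)"
    by (intro real_polynomial_function_compose polynomial_function_bounded_linear
        bounded_linear_fst) auto
  then show ?case
    using pCons.IH real_polynomial_function.intros(1)[OF bounded_linear_snd]
    by (auto simp: o_def intro!: real_polynomial_function.intros(3,4))
qed

text \<open>Follows the generation of polynomial functions; only a linear \<open>l\<close> needs an
  argument, and it splits as l(c, 0) + t l(0, 1).\<close>

lemma real_polynomial_function_prod_eq_specialize:
  fixes Q :: "'a::real_normed_vector \<times> real \<Rightarrow> real"
  assumes "real_polynomial_function Q"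
  obtains R where "\<And>c t. Q (c, t) = poly (specialize R c) t"
proof -
  have "\<exists>R. \<forall>c t. Q (c, t) = poly (specialize R c) t"
    using assms
  proof (induction rule: real_polynomial_function.induct)
    case (linear l)
    have "real_polynomial_function (\<lambda>c. l (c, 0))"
      by (intro real_polynomial_function.intros bounded_linear_compose[OF linear]
          bounded_linear_Pair bounded_linear_ident bounded_linear_zero)
    then obtain r where r: "eval_polyfun r = (\<lambda>c. l (c, 0))"
      by (metis Abs_polyfun_inverse mem_Collect_eq)
    obtain s :: "'a polyfun" where s: "eval_polyfun s = (\<lambda>c. l (0, 1))"
      by (metis Abs_polyfun_inverse mem_Collect_eq real_polynomial_function.intros(2))
    have decomp: "l (c, t) = l (c, 0) + t * l (0, 1)" for c t
    proof -
      have "l ((c, 0) + t *\<^sub>R (0, 1)) = l (c, 0) + t * l (0, 1)"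
        using bounded_linear.linear[OF linear] by (simp only: linear_add linear_cmul real_scaleR_def)
      then show ?thesis by simp
    qed
    show ?case
    proof (intro exI[of _ "[:r, s:]"] allI)
      show "l (c, t) = poly (specialize [:r, s:] c) t" for c t
        by (subst decomp) (simp add: r s)
    qed
  next
    case (const k)
    obtain s :: "'a polyfun" where s: "eval_polyfun s = (\<lambda>c. k)"
      by (metis Abs_polyfun_inverse mem_Collect_eq real_polynomial_function.intros(2))
    then show ?case
      by (intro exI[of _ "[:s:]"]) simp
  next
    case (add p q)
    then obtain R S where "\<forall>c t. p (c, t) = poly (specialize R c) t"
      "\<forall>c t. q (c, t) = poly (specialize S c) t" by blast
    then show ?case by (intro exI[of _ "R + S"]) simp
  next
    case (mult p q)
    then obtain R S where "\<forall>c t. p (c, t) = poly (specialize R c) t"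
      "\<forall>c t. q (c, t) = poly (specialize S c) t" by blast
    then show ?case by (intro exI[of _ "R * S"]) simp
  qed
  then show thesis using that by blast
qed

text \<open>Apply algebraic dependence to \<open>u / v\<close> together with \<open>h\<close>, and divide the relation by
  the largest possible power of the variable standing for \<open>h\<close>.\<close>

lemma image_of_hypersurface_algebraic:
  fixes u :: "'a::euclidean_space \<Rightarrow> 'b::euclidean_space" and v h :: "'a \<Rightarrow> real"
  assumes u: "polynomial_function u" and v: "real_polynomial_function v"
    and h: "real_polynomial_function h" "h x0 \<noteq> 0" and dim: "DIM('a) \<le> DIM('b)"
  shows "\<exists>D. real_polynomial_function D \<and> (\<exists>y. D y \<noteq> 0) \<and>
    (\<forall>x. v x \<noteq> 0 \<longrightarrow> h x = 0 \<longrightarrow> D (u x /\<^sub>R v x) = 0)"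
proof -
  \<comment> \<open>The second coordinate is multiplied by \<open>v x\<close> because division by
    \<open>v x\<close> is applied to the whole pair and should leave \<open>h x\<close>.\<close>
  have "polynomial_function (\<lambda>x. (u x, v x * h x))"
  proof -
    have "real_polynomial_function (\<lambda>x. (u x, v x * h x) \<bullet> b)" if b: "b \<in> Basis" for b
      using b u v h unfolding Basis_prod_def
      by (auto simp: polynomial_function_iff_Basis_inner real_polynomial_function.intros(4))
    then show ?thesis by (simp add: polynomial_function_iff_Basis_inner)
  qed
  moreover have "DIM('a) < DIM('b \<times> real)"
    using dim by simp
  ultimately obtain Q where Q: "real_polynomial_function Q" "\<exists>y. Q y \<noteq> 0"
    "\<And>x. v x \<noteq> 0 \<Longrightarrow> Q ((u x, v x * h x) /\<^sub>R v x) = 0"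
    using polynomials_algebraically_dependent[OF _ v] by blast
  obtain R where R: "\<And>c t. Q (c, t) = poly (specialize R c) t"
    using real_polynomial_function_prod_eq_specialize[OF Q(1)] by blast
  have "R \<noteq> 0"
    using Q(2) R by (metis poly_0 specialize_simps(1) surj_pair)
  then obtain q where q: "R = [:0, 1:] ^ order 0 R * q" "\<not> [:0, 1:] dvd q"
    using order_decomp[of R 0] by auto
  have q0: "coeff q 0 \<noteq> 0"
    using q(2) by (metis dvd_iff_poly_eq_0 minus_zero poly_0_coeff_0)
  define \<phi> where "\<phi> x = poly (specialize q (u x /\<^sub>R v x)) (h x)" for x
  \<comment> \<open>The power of \<open>h x\<close> can be cancelled only off the hypersurface.
    Continuity of \<open>\<phi>\<close> and density of the points with \<open>h x \<noteq> 0\<close>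
    then extend the vanishing to the hypersurface, where \<open>\<phi>\<close> reduces to the
    constant coefficient of \<open>q\<close>.\<close>
  have \<phi>0: "\<phi> x = 0" if "v x \<noteq> 0" "h x \<noteq> 0" for x
  proof -
    have "0 = poly (specialize R (u x /\<^sub>R v x)) (h x)"
      using Q(3)[OF that(1)] that(1) R by (simp flip: mult.assoc)
    also have "\<dots> = h x ^ order 0 R * \<phi> x"
      by (subst q(1)) (simp add: \<phi>_def)
    finally show ?thesis using that(2) by simp
  qed
  show ?thesis
  proof (intro exI[of _ "eval_polyfun (coeff q 0)"] conjI allI impI)
    show "\<exists>y. eval_polyfun (coeff q 0) y \<noteq> 0"
      using q0 polyfun_nonzero_iff by blast
    fix x assume x: "v x \<noteq> 0" "h x = 0"
    have "isCont (\<lambda>x. (u x /\<^sub>R v x, h x)) x"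
      using x(1) continuous_polymonial_function[OF u] continuous_real_polymonial_function[OF v]
        continuous_real_polymonial_function[OF h(1)]
      by (intro continuous_intros) auto
    then have cont: "isCont \<phi> x"
      unfolding \<phi>_def
      using isCont_o2[OF _ continuous_real_polymonial_function[OF
            real_polynomial_function_specialize[of q]]] by fastforce
    have "\<phi> x = 0"
    proof (rule ccontr)
      assume "\<phi> x \<noteq> 0"
      then have "\<forall>\<^sub>F z in nhds x. \<phi> z \<noteq> 0"
        by (rule nonzero_nearby[OF cont])
      moreover have "\<forall>\<^sub>F z in nhds x. v z \<noteq> 0"
        by (rule nonzero_nearby[OF continuous_real_polymonial_function[OF v] x(1)])
      ultimately have "\<forall>\<^sub>F z in nhds x. \<phi> z \<noteq> 0 \<and> v z \<noteq> 0"
        by eventually_elim simp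
      then obtain U where "open U" "x \<in> U" "\<forall>z\<in>U. \<phi> z \<noteq> 0 \<and> v z \<noteq> 0"
        unfolding eventually_nhds by blast
      then show False
        using real_polynomial_function_nonzero_in_open[OF h] \<phi>0 by metis
    qed
    then show "eval_polyfun (coeff q 0) (u x /\<^sub>R v x) = 0"
      by (simp add: \<phi>_def x(2) poly_0_coeff_0)
  qed auto
qed

text \<open>An annihilator \<open>R\<close> of least degree is squarefree: were \<open>S\<close> a nonconstant common divisor of
  \<open>R\<close> and its derivative, the cofactor of \<open>S\<close> in \<open>R\<close> would have the same roots.\<close>

lemma separable_annihilator:
  fixes T :: "('a::real_normed_vector \<times> real) set"
  assumes "real_polynomial_function Q" "\<exists>z. Q z \<noteq> 0" "\<And>z. z \<in> T \<Longrightarrow> Q z = 0"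
  shows "\<exists>R D. D \<noteq> 0 \<and> (\<forall>(c, t)\<in>T. poly (specialize R c) t = 0) \<and>
    (\<forall>c. eval_polyfun D c \<noteq> 0 \<longrightarrow> specialize R c \<noteq> 0 \<and>
      (\<forall>t. poly (specialize R c) t = 0 \<longrightarrow> poly (pderiv (specialize R c)) t \<noteq> 0))"
proof -
  define ann where "ann R \<longleftrightarrow> R \<noteq> 0 \<and> (\<forall>(c, t)\<in>T. poly (specialize R c) t = 0)"
    for R :: "'a polyfun poly"
  obtain R0 where R0: "\<And>c t. Q (c, t) = poly (specialize R0 c) t"
    using real_polynomial_function_prod_eq_specialize[OF assms(1)] by blast
  have "R0 \<noteq> 0"
    using assms(2) R0 by (metis poly_0 specialize_simps(1) surj_pair)
  then have "ann R0"
    unfolding ann_def using assms(3) R0 by auto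
  then obtain R where R: "ann R" "\<And>A. ann A \<Longrightarrow> degree R \<le> degree A"
    using ex_has_least_nat[of ann R0 degree] by blast
  \<comment> \<open>The ideal generated by \<open>R\<close> and its derivative. The coefficients do
    not form a field; still, by pseudo-division, a nonzero element \<open>S\<close> of least degree
    divides every member up to a nonzero factor from the coefficient ring, and so replaces the
    greatest common divisor.\<close>
  define comb where "comb S \<longleftrightarrow> (\<exists>U V. S = U * R + V * pderiv R)" for S
  have comb_R: "comb R"
    unfolding comb_def by (rule exI[of _ 1], rule exI[of _ 0]) simp
  have comb_R': "comb (pderiv R)"
    unfolding comb_def by (rule exI[of _ 0], rule exI[of _ 1]) simp
  have comb_diff: "comb (X * S - Y * S')" if S: "comb S" "comb S'" for X Y S S'
  proof -
    obtain U V U' V' where "S = U * R + V * pderiv R" "S' = U' * R + V' * pderiv R"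
      using S unfolding comb_def by blast
    then have "X * S - Y * S' = (X * U - Y * U') * R + (X * V - Y * V') * pderiv R"
      by (simp add: algebra_simps)
    then show ?thesis unfolding comb_def by blast
  qed
  have Rnz: "R \<noteq> 0" using R(1) by (simp add: ann_def)
  obtain S where S: "S \<noteq> 0" "comb S" "\<And>X. X \<noteq> 0 \<Longrightarrow> comb X \<Longrightarrow> degree S \<le> degree X"
    using ex_has_least_nat[of "\<lambda>S. S \<noteq> 0 \<and> comb S" R degree] Rnz comb_R by blast
  have divides: "\<exists>a B. a \<noteq> 0 \<and> smult a X = S * B" if X: "comb X" for X
  proof -
    obtain a B where aB: "a \<noteq> 0" "smult a X = S * B + pseudo_mod X S"
      using pseudo_mod(1)[OF S(1)] by blast
    then have "pseudo_mod X S = [:a:] * X - B * S"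
      by (simp add: algebra_simps)
    then have "comb (pseudo_mod X S)"
      using comb_diff[OF X S(2)] by metis
    then have "pseudo_mod X S = 0"
      using pseudo_mod(2)[OF S(1), of X] S(3) by (meson leD)
    then show ?thesis using aB by auto
  qed
  have "degree S = 0"
  proof (rule ccontr)
    assume deg: "degree S \<noteq> 0"
    obtain a A where A: "a \<noteq> 0" "smult a R = S * A"
      using divides[OF comb_R] by blast
    obtain b B where B: "b \<noteq> 0" "smult b (pderiv R) = S * B"
      using divides[OF comb_R'] by blast
    have Anz: "A \<noteq> 0"
      using A Rnz by auto
    have "degree R = degree S + degree A"
      using A S(1) Anz by (metis degree_mult_eq degree_smult_eq)
    then have degA: "degree A < degree R" using deg by simp
    \<comment> \<open>The scalar makes \<open>A'\<close> vanish trivially at every \<open>c\<close>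
      where \<open>a\<close>, \<open>b\<close> or the leading coefficient of \<open>R\<close>
      vanishes, so multiplicities are compared only at parameters where specialization is
      harmless.\<close>
    define A' where "A' = smult (a * b * lead_coeff R) A"
    have "poly (specialize A' c) t = 0" if ct: "(c, t) \<in> T" for c t
    proof (rule ccontr)
      let ?R = "specialize R c" and ?S = "specialize S c"
        and ?A = "specialize A c" and ?B = "specialize B c"
      assume "poly (specialize A' c) t \<noteq> 0"
      then have nz: "eval_polyfun a c \<noteq> 0" "eval_polyfun b c \<noteq> 0"
        "eval_polyfun (lead_coeff R) c \<noteq> 0" "poly ?A t \<noteq> 0"
        by (auto simp: A'_def)
      have Rc: "?R \<noteq> 0"
        using nz(3) by (metis coeff_0 coeff_specialize)
      have root: "poly ?R t = 0"
        using R(1) ct by (auto simp: ann_def)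
      have 1: "smult (eval_polyfun a c) ?R = ?S * ?A"
        using arg_cong[OF A(2), of "\<lambda>X. specialize X c"] by simp
      have 2: "smult (eval_polyfun b c) (pderiv ?R) = ?S * ?B"
        using arg_cong[OF B(2), of "\<lambda>X. specialize X c"] by simp
      have "degree ?R \<noteq> 0"
        using Rc root by (metis degree_eq_zeroE pCons_0_0 mult_zero_right poly_0 add.right_neutral poly_pCons)
      then have dnz: "pderiv ?R \<noteq> 0"
        by (simp add: pderiv_eq_0_iff)
      \<comment> \<open>As \<open>?A\<close> is nonzero at \<open>t\<close>, the full multiplicity
        of \<open>t\<close> in \<open>?R\<close> comes from \<open>?S\<close>, which divides a
        nonzero multiple of \<open>pderiv ?R\<close>; but differentiation lowers the multiplicity of
        a root by one.\<close>
      have "order t ?R = order t (?S * ?A)"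
        using nz(1) by (simp add: order_smult flip: 1)
      also have "\<dots> = order t ?S + order t ?A"
        using 1 Rc nz(1) by (intro order_mult) (metis smult_eq_0_iff)
      also have "\<dots> = order t ?S"
        using nz(4) by (simp add: order_0I)
      also have "\<dots> \<le> order t ?S + order t ?B" by simp
      also have "\<dots> = order t (?S * ?B)"
        using 2 dnz nz(2) by (intro order_mult[symmetric]) (metis smult_eq_0_iff)
      also have "\<dots> = order t (pderiv ?R)"
        using nz(2) by (simp add: order_smult flip: 2)
      finally show False
        using order_pderiv[OF Rc root] by simp
    qed
    then have "ann A'"
      unfolding ann_def A'_def using A(1) B(1) Rnz Anz by auto
    moreover have "degree A' = degree A"
      using A(1) B(1) Rnz by (simp add: A'_def)
    ultimately show False using R(2) degA by fastforce
  qed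
  then obtain D where D: "S = [:D:]" "D \<noteq> 0"
    using S(1) by (metis degree_eq_zeroE pCons_0_0)
  \<comment> \<open>A Bezout identity over the coefficient ring: where \<open>D\<close> is nonzero,
    a specialization of \<open>R\<close> can neither be zero nor share a root with its
    derivative.\<close>
  obtain U V where UV: "[:D:] = U * R + V * pderiv R"
    using S(2) unfolding comb_def D(1) by blast
  have Dc: "eval_polyfun D c = poly (specialize U c) t * poly (specialize R c) t +
      poly (specialize V c) t * poly (pderiv (specialize R c)) t" for c t
    using arg_cong[OF UV, of "\<lambda>X. poly (specialize X c) t"] by simp
  show ?thesis
  proof (intro exI[of _ R] exI[of _ D] conjI allI impI)
    show "D \<noteq> 0" by fact
    show "\<forall>(c, t)\<in>T. poly (specialize R c) t = 0"
      using R(1) by (simp add: ann_def)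
    fix c assume "eval_polyfun D c \<noteq> 0"
    then show "specialize R c \<noteq> 0"
      using Dc[of c 0] by auto
    show "poly (pderiv (specialize R c)) t \<noteq> 0" if "poly (specialize R c) t = 0" for t
      using Dc[of c t] that \<open>eval_polyfun D c \<noteq> 0\<close> by auto
  qed
qed

text \<open>By the chain rule the coefficients contribute nothing, since the parameter curve has
  zero velocity. Hence it is enough that the parameter be constant to first order.\<close>

lemma specialize_has_derivative_along_curve:
  fixes \<gamma> :: "real \<Rightarrow> 'a::euclidean_space"
  assumes \<gamma>: "(\<gamma> has_vector_derivative 0) (at s)" and t: "(t has_real_derivative \<omega>) (at s)"
  shows "((\<lambda>s. poly (specialize R (\<gamma> s)) (t s)) has_real_derivative
    poly (pderiv (specialize R (\<gamma> s))) (t s) * \<omega>) (at s)"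
proof (induction R)
  case 0
  then show ?case by simp
next
  case (pCons r R)
  obtain F where F: "(eval_polyfun r has_derivative F) (at (\<gamma> s))"
    using differentiable_at_real_polynomial_function[OF real_polynomial_function_eval_polyfun[of r]]
    unfolding differentiable_def by blast
  have "((\<lambda>s. eval_polyfun r (\<gamma> s)) has_derivative (\<lambda>h. F (h *\<^sub>R 0))) (at s)"
    using diff_chain_at[OF \<gamma>[unfolded has_vector_derivative_def] F] by (simp add: o_def)
  moreover have "F 0 = 0"
    using has_derivative_bounded_linear[OF F] bounded_linear.linear linear_0 by blast
  ultimately have r: "((\<lambda>s. eval_polyfun r (\<gamma> s)) has_real_derivative 0) (at s)"
    by (simp add: has_field_derivative_def lambda_zero)
  show ?case
    unfolding specialize_simps poly_pCons pderiv_pCons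
    by (rule derivative_eq_intros r t pCons.IH refl)+ (simp add: algebra_simps)
qed

section \<open>Generic parameters\<close>

lemma has_vector_derivative_along_line:
  assumes "(g has_derivative G) (at p)"
  shows "((\<lambda>s. g (p + s *\<^sub>R \<omega>)) has_vector_derivative G \<omega>) (at 0)"
proof -
  have "((\<lambda>s. p + s *\<^sub>R \<omega>) has_derivative (\<lambda>s. s *\<^sub>R \<omega>)) (at 0)"
    by (auto intro!: derivative_eq_intros)
  then have "(g \<circ> (\<lambda>s. p + s *\<^sub>R \<omega>) has_derivative G \<circ> (\<lambda>s. s *\<^sub>R \<omega>)) (at 0)"
    using assms by (intro diff_chain_at) auto
  moreover have "G (s *\<^sub>R \<omega>) = s *\<^sub>R G \<omega>" for s
    using has_derivative_bounded_linear[OF assms] bounded_linear.linear linear_cmul by blast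
  ultimately show ?thesis
    by (simp add: has_vector_derivative_def o_def)
qed

text \<open>A curve that satisfies \<open>a w\<^sup>2 - b w + 1 = 0\<close> to first order agrees to first order with
  one of the explicit solutions \<open>2 / (b \<plusminus> sqrt (b\<^sup>2 - 4 a))\<close>.\<close>

lemma quadratic_root_along_curve:
  fixes a b w :: "real \<Rightarrow> real"
  assumes a: "(a has_real_derivative a') (at 0)" and b: "(b has_real_derivative b') (at 0)"
    and w: "(w has_real_derivative w') (at 0)"
    and first_order: "((\<lambda>s. a s * (w s)\<^sup>2 - b s * w s + 1) has_real_derivative 0) (at 0)"
    and root: "a 0 * (w 0)\<^sup>2 - b 0 * w 0 + 1 = 0" and simple: "b 0 * w 0 \<noteq> 2"
  obtains v where "v 0 = w 0" "(v has_real_derivative w') (at 0)"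
    "\<forall>\<^sub>F s in nhds 0. a s * (v s)\<^sup>2 - b s * v s + 1 = 0"
proof -
  have w0: "w 0 \<noteq> 0" using root by auto
  \<comment> \<open>Writing w = 2 / (b + y) shows that \<open>y\<close> is the square root of b^2 -
    4 a, with the sign belonging to the root \<open>w 0\<close>; \<open>simple\<close> says that it
    is nonzero.\<close>
  define y where "y = 2 / w 0 - b 0"
  have "y \<noteq> 0"
    using simple w0 by (auto simp: y_def field_simps)
  define \<sigma> where "\<sigma> = sgn y"
  have \<sigma>: "\<sigma> * \<sigma> = 1"
    using \<open>y \<noteq> 0\<close> by (auto simp: \<sigma>_def sgn_if)
  define \<Delta> where "\<Delta> s = (b s)\<^sup>2 - 4 * a s" for s
  have \<Delta>0: "\<Delta> 0 = y\<^sup>2"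
    using root w0 by (simp add: \<Delta>_def y_def field_simps power2_eq_square)
  then have \<Delta>pos: "\<Delta> 0 > 0" using \<open>y \<noteq> 0\<close> by simp
  have \<sigma>y: "\<sigma> * sqrt (\<Delta> 0) = y"
    unfolding \<Delta>0 \<sigma>_def by (simp add: sgn_mult_abs)
  have \<Delta>': "(\<Delta> has_real_derivative 2 * b 0 * b' - 4 * a') (at 0)"
    unfolding \<Delta>_def using a b by (auto intro!: derivative_eq_intros)
  \<comment> \<open>The reciprocal form of the root formula does not divide by \<open>a\<close>,
    which may vanish: later \<open>a\<close> is the squared norm of the gradient of f.\<close>
  define d where "d s = b s + \<sigma> * sqrt (\<Delta> s)" for s
  have d0: "d 0 = 2 / w 0"
    by (simp add: d_def \<sigma>y) (simp add: y_def)
  have d0nz: "d 0 \<noteq> 0" using w0 by (simp add: d0)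
  obtain d' where d': "(d has_real_derivative d') (at 0)"
  proof
    show "(d has_real_derivative b' + \<sigma> * ((2 * b 0 * b' - 4 * a') * (inverse (sqrt (\<Delta> 0)) / 2))) (at 0)"
      unfolding d_def using b \<Delta>' \<Delta>pos
      by (auto intro!: derivative_eq_intros)
  qed
  define v where "v s = 2 / d s" for s
  have v0: "v 0 = w 0" by (simp add: v_def d0)
  obtain v' where v': "(v has_real_derivative v') (at 0)"
    unfolding v_def using DERIV_divide[OF DERIV_const d' d0nz] by blast
  have "\<forall>\<^sub>F s in nhds 0. \<Delta> s > 0"
    using order_tendstoD(1)[OF DERIV_isCont[OF \<Delta>', unfolded isCont_def] \<Delta>pos] \<Delta>pos
    by (simp add: eventually_nhds_conv_at)
  moreover have "\<forall>\<^sub>F s in nhds 0. d s \<noteq> 0"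
    by (rule nonzero_nearby[OF DERIV_isCont[OF d'] d0nz])
  ultimately have ev: "\<forall>\<^sub>F s in nhds 0. a s * (v s)\<^sup>2 - b s * v s + 1 = 0"
  proof eventually_elim
    case (elim s)
    have "(\<sigma> * sqrt (\<Delta> s))\<^sup>2 = \<Delta> s"
      using elim \<sigma> by (simp add: power_mult_distrib power2_eq_square[of \<sigma>])
    then have "(d s - b s)\<^sup>2 = (b s)\<^sup>2 - 4 * a s"
      by (simp add: d_def \<Delta>_def)
    then have "(d s)\<^sup>2 - 2 * b s * d s + 4 * a s = 0"
      by (simp add: power2_diff algebra_simps)
    then show ?case
      using elim(2) by (simp add: v_def field_simps power2_eq_square)
  qed
  have "((\<lambda>s. a s * (v s)\<^sup>2 - b s * v s + 1) has_real_derivative 0) (at 0)"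
    using DERIV_cong_ev[OF refl ev refl] by simp
  moreover have "((\<lambda>s. a s * (v s)\<^sup>2 - b s * v s + 1) has_real_derivative
      (a' * (w 0)\<^sup>2 + a 0 * (2 * w 0 * v') - (b' * w 0 + b 0 * v'))) (at 0)"
    using a b v' by (auto intro!: derivative_eq_intros simp: v0)
  ultimately have 1: "a' * (w 0)\<^sup>2 + a 0 * (2 * w 0 * v') - (b' * w 0 + b 0 * v') = 0"
    using DERIV_unique by blast
  have "((\<lambda>s. a s * (w s)\<^sup>2 - b s * w s + 1) has_real_derivative
      (a' * (w 0)\<^sup>2 + a 0 * (2 * w 0 * w') - (b' * w 0 + b 0 * w'))) (at 0)"
    using a b w by (auto intro!: derivative_eq_intros)
  then have 2: "a' * (w 0)\<^sup>2 + a 0 * (2 * w 0 * w') - (b' * w 0 + b 0 * w') = 0"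
    using DERIV_unique first_order by blast
  \<comment> \<open>Difference of the two linearized equations; the first factor is the derivative
    of the quadratic in w, nonzero at a simple root.\<close>
  have "(2 * a 0 * w 0 - b 0) * (v' - w') = 0"
    using 1 2 by (simp add: algebra_simps)
  moreover have "w 0 * (2 * a 0 * w 0 - b 0) = b 0 * w 0 - 2"
    using root by (simp add: algebra_simps power2_eq_square)
  ultimately have "v' = w'" using simple by auto
  then show thesis using that v0 v' ev by blast
qed

section \<open>Critical points as a hypersurface over the parameter space\<close>

locale polynomial_with_gradient =
  fixes f :: "'a::euclidean_space \<Rightarrow> real" and f' :: "'a \<Rightarrow> 'a" and k :: real
  assumes f: "real_polynomial_function f" and f': "polynomial_function f'"
    and f_has_derivative: "(f has_derivative (\<lambda>h. f' x \<bullet> h)) (at x)"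
    and k: "k > 0"
begin

text \<open>Where \<open>f\<close> does not vanish, \<open>critical_field c\<close> is a nonvanishing multiple of the gradient of
  \<open>f\<^sup>2 / (\<bar>x - c\<bar>\<^sup>2 + 1)\<^sup>k\<close>.\<close>

definition critical_field :: "'a \<Rightarrow> 'a \<Rightarrow> 'a" where
  "critical_field c x = ((x - c) \<bullet> (x - c) + 1) *\<^sub>R f' x - (k * f x) *\<^sub>R (x - c)"

definition quadratic :: "'a \<Rightarrow> real \<Rightarrow> real" where
  "quadratic x w = (f' x \<bullet> f' x) * w\<^sup>2 - (k * f x) * w + 1"

text \<open>The value of w forced at a critical point: there w f'(x) = x - c, and taking squared
  norms gives |f'(x)|^2 w^2 = |x - c|^2 = k f(x) w - 1, the equation
  \<open>quadratic x w = 0\<close>.\<close>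

definition multiplier :: "'a \<Rightarrow> 'a \<Rightarrow> real" where
  "multiplier c x = ((x - c) \<bullet> (x - c) + 1) / (k * f x)"

definition discriminant :: "'a \<Rightarrow> real" where
  "discriminant x = (k * f x)\<^sup>2 - 4 * (f' x \<bullet> f' x)"

lemma multiplier_scaleR:
  assumes "f x \<noteq> 0"
  shows "multiplier c x *\<^sub>R f' x = (x - c) + (1 / (k * f x)) *\<^sub>R critical_field c x"
  using assms k unfolding multiplier_def critical_field_def by (simp add: scaleR_diff_right)

text \<open>Stated off the critical set as well, with an explicit residual: along a curve on which
  \<open>critical_field c\<close> vanishes to first order, the residual does too.\<close>

lemma quadratic_multiplier:
  assumes "f x \<noteq> 0"
  shows "quadratic x (multiplier c x) =
    2 * ((x - c) \<bullet> critical_field c x) / (k * f x) +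
    (critical_field c x \<bullet> critical_field c x) / (k * f x)\<^sup>2"
proof -
  let ?y = "(1 / (k * f x)) *\<^sub>R critical_field c x"
  have "quadratic x (multiplier c x) =
      (multiplier c x *\<^sub>R f' x) \<bullet> (multiplier c x *\<^sub>R f' x) - k * f x * multiplier c x + 1"
    by (simp add: quadratic_def power2_eq_square algebra_simps)
  also have "\<dots> = ((x - c) + ?y) \<bullet> ((x - c) + ?y) - (x - c) \<bullet> (x - c)"
    unfolding multiplier_scaleR[OF assms] using assms k by (simp add: multiplier_def)
  also have "\<dots> = 2 * ((x - c) \<bullet> ?y) + ?y \<bullet> ?y"
    by (simp only: inner_add inner_commute[of ?y "x - c"])
  finally show ?thesis by (simp add: power2_eq_square)
qed

text \<open>Along the line p + s \<omega> the multiplier solves the quadratic to first order.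
  Replacing it by an exact root v(s) gives a curve in W over the parameters \<gamma>(s) = x - v
  f'(x). Root and multiplier agree to first order, and with the multiplier in place of v the
  parameter would be c up to a term of zero velocity.\<close>

lemma critical_field_differentiable_imp_first_order:
  assumes fp: "f p \<noteq> 0" and crit: "critical_field c p = 0"
    and L: "(critical_field c has_derivative L) (at p)" "L \<omega> = 0"
    and simple: "k * f p * multiplier c p \<noteq> 2"
  obtains \<gamma> where "\<gamma> 0 = c" "(\<gamma> has_vector_derivative 0) (at 0)"
    "\<forall>\<^sub>F s in nhds 0. \<exists>v. quadratic (p + s *\<^sub>R \<omega>) v = 0 \<and>
      \<gamma> s = (p + s *\<^sub>R \<omega>) - v *\<^sub>R f' (p + s *\<^sub>R \<omega>)"
proof -
  define X where "X s = p + s *\<^sub>R \<omega>" for s :: real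
  define b where "b s = k * f (X s)" for s
  define a where "a s = f' (X s) \<bullet> f' (X s)" for s
  define w where "w s = multiplier c (X s)" for s
  define \<phi> where "\<phi> s = critical_field c (X s)" for s
  have X0 [simp]: "X 0 = p" by (simp add: X_def)
  have \<phi>0 [simp]: "\<phi> 0 = 0" by (simp add: \<phi>_def crit)
  have b0: "b 0 \<noteq> 0" using fp k by (simp add: b_def)
  have X': "(X has_vector_derivative \<omega>) (at 0)"
    unfolding X_def by (auto intro!: derivative_eq_intros simp: has_vector_derivative_def)
  have \<phi>': "(\<phi> has_vector_derivative 0) (at 0)"
    unfolding \<phi>_def X_def using has_vector_derivative_along_line[OF L(1), of \<omega>] L(2) by simp
  obtain E where E: "((\<lambda>s. f' (X s)) has_vector_derivative E) (at 0)"
  proof -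
    obtain F' where "(f' has_derivative F') (at p)"
      using differentiable_at_polynomial_function[OF f'] unfolding differentiable_def by blast
    then show thesis
      using has_vector_derivative_along_line[of f' F' p \<omega>] that by (simp add: X_def)
  qed
  have fX: "((\<lambda>s. f (X s)) has_real_derivative f' p \<bullet> \<omega>) (at 0)"
    using has_vector_derivative_along_line[OF f_has_derivative, of p \<omega>]
    by (simp add: X_def has_real_derivative_iff_has_vector_derivative)
  have b': "(b has_real_derivative k * (f' p \<bullet> \<omega>)) (at 0)"
    unfolding b_def by (rule DERIV_cmult[OF fX])
  have inner': "((\<lambda>s. g s \<bullet> h s) has_real_derivative g 0 \<bullet> h' + g' \<bullet> h 0) (at 0)"
    if "(g has_vector_derivative g') (at 0)" "(h has_vector_derivative h') (at 0)"
    for g h :: "real \<Rightarrow> 'a" and g' h'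
    using bounded_bilinear.has_vector_derivative[OF bounded_bilinear_inner that]
    by (simp add: has_real_derivative_iff_has_vector_derivative)
  have a': "(a has_real_derivative f' p \<bullet> E + E \<bullet> f' p) (at 0)"
    unfolding a_def using inner'[OF E E] by simp
  have Xc: "((\<lambda>s. X s - c) has_vector_derivative \<omega>) (at 0)"
    using has_vector_derivative_diff[OF X' has_vector_derivative_const[of c]] by simp
  have q': "((\<lambda>s. (X s - c) \<bullet> (X s - c) + 1) has_real_derivative
      (p - c) \<bullet> \<omega> + \<omega> \<bullet> (p - c)) (at 0)"
    using DERIV_add[OF inner'[OF Xc Xc] DERIV_const[of 1]] by simp
  obtain w' where w': "(w has_real_derivative w') (at 0)"
  proof -
    have "w = (\<lambda>s. ((X s - c) \<bullet> (X s - c) + 1) / b s)"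
      by (rule ext) (simp add: w_def multiplier_def b_def)
    then show thesis using that DERIV_divide[OF q' b' b0] by metis
  qed
  have bnz: "\<forall>\<^sub>F s in nhds 0. b s \<noteq> 0"
    by (rule nonzero_nearby[OF DERIV_isCont[OF b'] b0])
  have quad: "quadratic (X s) v = a s * v\<^sup>2 - b s * v + 1" for s v
    by (simp add: quadratic_def a_def b_def)
  have residual: "\<forall>\<^sub>F s in nhds 0. a s * (w s)\<^sup>2 - b s * w s + 1 =
      2 * ((X s - c) \<bullet> \<phi> s) / b s + (\<phi> s \<bullet> \<phi> s) / (b s)\<^sup>2"
    using bnz
  proof eventually_elim
    case (elim s)
    then have "f (X s) \<noteq> 0" by (auto simp: b_def)
    from quadratic_multiplier[OF this, of c] show ?case
      by (simp add: quad w_def \<phi>_def b_def)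
  qed
  have residual': "((\<lambda>s. 2 * ((X s - c) \<bullet> \<phi> s) / b s + (\<phi> s \<bullet> \<phi> s) / (b s)\<^sup>2)
      has_real_derivative 0) (at 0)"
    using DERIV_add[OF DERIV_divide[OF DERIV_cmult[OF inner'[OF Xc \<phi>'], of 2] b' b0]
        DERIV_divide[OF inner'[OF \<phi>' \<phi>'] DERIV_power[OF b', of 2]]] b0
    by simp
  have first_order: "((\<lambda>s. a s * (w s)\<^sup>2 - b s * w s + 1) has_real_derivative 0) (at 0)"
    using residual' by (rule iffD2[OF DERIV_cong_ev[OF refl residual refl]])
  have root: "a 0 * (w 0)\<^sup>2 - b 0 * w 0 + 1 = 0"
    using quadratic_multiplier[OF fp, of c] by (simp add: quad[symmetric] w_def crit)
  have simple': "b 0 * w 0 \<noteq> 2"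
    using simple by (simp add: b_def w_def)
  obtain v where v: "v 0 = w 0" "(v has_real_derivative w') (at 0)"
      "\<forall>\<^sub>F s in nhds 0. a s * (v s)\<^sup>2 - b s * v s + 1 = 0"
    using quadratic_root_along_curve[OF a' b' w' first_order root simple'] by blast
  define \<gamma> where "\<gamma> s = X s - v s *\<^sub>R f' (X s)" for s
  have \<gamma>': "(\<gamma> has_vector_derivative \<omega> - (w 0 *\<^sub>R E + w' *\<^sub>R f' p)) (at 0)"
    unfolding \<gamma>_def
    using has_vector_derivative_diff[OF X' has_vector_derivative_scaleR[OF v(2) E]] v(1) by simp
  \<comment> \<open>The same velocity formula as for \<open>\<gamma>\<close>, now for the multiplier
    \<open>w\<close>, whose curve is c minus a multiple of \<open>\<phi>\<close>. Comparing the two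
    derivatives shows that the formula has value 0.\<close>
  have "((\<lambda>s. X s - w s *\<^sub>R f' (X s)) has_vector_derivative \<omega> - (w 0 *\<^sub>R E + w' *\<^sub>R f' p)) (at 0)"
    using has_vector_derivative_diff[OF X' has_vector_derivative_scaleR[OF w' E]] by simp
  moreover have "((\<lambda>s. X s - w s *\<^sub>R f' (X s)) has_vector_derivative 0) (at 0)"
  proof -
    have ev: "\<forall>\<^sub>F s in nhds 0. X s - w s *\<^sub>R f' (X s) = c - (1 / b s) *\<^sub>R \<phi> s"
      using bnz
    proof eventually_elim
      case (elim s)
      then have "f (X s) \<noteq> 0" by (auto simp: b_def)
      from multiplier_scaleR[OF this, of c] show ?case
        by (simp add: w_def b_def \<phi>_def)
    qed
    have "((\<lambda>s. c - (1 / b s) *\<^sub>R \<phi> s) has_vector_derivative 0) (at 0)"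
      using has_vector_derivative_diff[OF has_vector_derivative_const[of c]
          has_vector_derivative_scaleR[OF DERIV_divide[OF DERIV_const[of 1] b' b0] \<phi>']]
      by simp
    moreover have "((\<lambda>s. X s - w s *\<^sub>R f' (X s)) has_vector_derivative 0) (at 0) =
        ((\<lambda>s. c - (1 / b s) *\<^sub>R \<phi> s) has_vector_derivative 0) (at 0)"
      by (rule has_vector_derivative_cong_ev)
         (use ev eventually_nhds_x_imp_x[OF ev] in \<open>auto elim: eventually_mono\<close>)
    ultimately show ?thesis by simp
  qed
  ultimately have "\<omega> - (w 0 *\<^sub>R E + w' *\<^sub>R f' p) = 0"
    by (rule vector_derivative_unique_at)
  then have "(\<gamma> has_vector_derivative 0) (at 0)"
    using \<gamma>' by simp
  moreover have "\<gamma> 0 = c"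
    using multiplier_scaleR[OF fp, of c] v(1) by (simp add: \<gamma>_def w_def crit)
  moreover have "\<forall>\<^sub>F s in nhds 0. \<exists>v. quadratic (p + s *\<^sub>R \<omega>) v = 0 \<and>
      \<gamma> s = (p + s *\<^sub>R \<omega>) - v *\<^sub>R f' (p + s *\<^sub>R \<omega>)"
    using v(3) by eventually_elim (auto simp: quad X_def[symmetric] \<gamma>_def)
  ultimately show thesis using that by blast
qed

lemma real_polynomial_function_inner_gradient: "real_polynomial_function (\<lambda>x. f' x \<bullet> f' x)"
proof -
  have "f' x \<bullet> f' x = (\<Sum>b\<in>Basis. (f' x \<bullet> b) * (f' x \<bullet> b))" for x
    by (rule euclidean_inner)
  then show ?thesis
    using f' by (auto simp: polynomial_function_iff_Basis_inner
        intro!: real_polynomial_function_sum real_polynomial_function.intros(4))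
qed

text \<open>The critical points for \<open>c\<close> are the points \<open>x\<close> of the solutions \<open>(x, w)\<close> of \<open>quadratic x w = 0\<close>
  with \<open>x - w f'(x) = c\<close>; double roots \<open>w\<close> are excluded for generic \<open>c\<close>.\<close>

lemma generic_critical_points:
  assumes nonzero: "discriminant x0 \<noteq> 0"
  obtains P where "real_polynomial_function P" "\<exists>y. P y \<noteq> 0"
    "\<And>c. P c \<noteq> 0 \<Longrightarrow> finite {x. f x \<noteq> 0 \<and> critical_field c x = 0}"
    "\<And>c x L \<omega>. P c \<noteq> 0 \<Longrightarrow> f x \<noteq> 0 \<Longrightarrow> critical_field c x = 0 \<Longrightarrow>
      (critical_field c has_derivative L) (at x) \<Longrightarrow> L \<omega> = 0 \<Longrightarrow> \<omega> = 0"
proof -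
  have f_poly: "real_polynomial_function (\<lambda>x. k * f x)"
    using f by auto
  have f'_poly: "real_polynomial_function (\<lambda>x. f' x \<bullet> b)" if "b \<in> Basis" for b
    using f' that by (simp add: polynomial_function_iff_Basis_inner)
  have discr_poly: "real_polynomial_function discriminant"
    unfolding discriminant_def
    by (intro real_polynomial_function_diff real_polynomial_function_power f_poly
        real_polynomial_function.intros(4) real_polynomial_function.intros(2)
        real_polynomial_function_inner_gradient)
  \<comment> \<open>A double root of the quadratic is w = 2 / (k f(x)). Divided by k f(x), this map
    is x - w f'(x), the parameter belonging to a double root, so \<open>D0\<close> vanishes at all
    such parameters.\<close>
  have "polynomial_function (\<lambda>x. (k * f x) *\<^sub>R x - 2 *\<^sub>R f' x)"
    using f_poly f' by (intro polynomial_function_diff polynomial_function_mult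
        polynomial_function_id polynomial_function_const) (simp_all add: real_polynomial_function_eq)
  from image_of_hypersurface_algebraic[OF this f_poly discr_poly nonzero]
  obtain D0 where D0: "real_polynomial_function D0" "\<exists>y. D0 y \<noteq> 0"
    "\<And>x. k * f x \<noteq> 0 \<Longrightarrow> discriminant x = 0 \<Longrightarrow>
      D0 (((k * f x) *\<^sub>R x - 2 *\<^sub>R f' x) /\<^sub>R (k * f x)) = 0"
    by auto
  obtain E0 where E0: "eval_polyfun E0 = D0"
    using D0(1) by (metis Abs_polyfun_inverse mem_Collect_eq)
  define T where "T b = {(x - w *\<^sub>R f' x, x \<bullet> b) |x w. quadratic x w = 0}" for b
  define sep where "sep b R D \<longleftrightarrow> D \<noteq> 0 \<and> (\<forall>(c, t)\<in>T b. poly (specialize R c) t = 0) \<and>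
      (\<forall>c. eval_polyfun D c \<noteq> 0 \<longrightarrow> specialize R c \<noteq> 0 \<and>
      (\<forall>t. poly (specialize R c) t = 0 \<longrightarrow> poly (pderiv (specialize R c)) t \<noteq> 0))" for b R D
  have "\<forall>b\<in>Basis. \<exists>R D. sep b R D"
  proof
    fix b :: 'a assume b: "b \<in> Basis"
    have fst_poly: "real_polynomial_function (\<lambda>z. g (fst z))" if "real_polynomial_function g"
      for g :: "'a \<Rightarrow> real"
      using real_polynomial_function_compose[OF polynomial_function_bounded_linear[OF bounded_linear_fst] that]
      by (simp add: o_def)
    have snd_poly: "real_polynomial_function (\<lambda>z::'a \<times> real. snd z)"
      by (intro real_polynomial_function.intros(1) bounded_linear_snd)
    have param_poly: "polynomial_function (\<lambda>z. (fst z - snd z *\<^sub>R f' (fst z), fst z \<bullet> b))"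
    proof -
      have "real_polynomial_function (\<lambda>z. (fst z - snd z *\<^sub>R f' (fst z), fst z \<bullet> b) \<bullet> e)"
        if "e \<in> Basis" for e :: "'a \<times> real"
      proof -
        have inner_poly: "real_polynomial_function (\<lambda>z::'a \<times> real. fst z \<bullet> d)" for d
          by (intro fst_poly real_polynomial_function.intros(1) bounded_linear_inner_left)
        from that consider "e = (0, 1)" | d where "e = (d, 0)" "d \<in> Basis"
          by (auto simp: Basis_prod_def)
        then show ?thesis
        proof cases
          case 1
          then show ?thesis using inner_poly by simp
        next
          case 2
          then show ?thesis
            using real_polynomial_function_diff[OF inner_poly
                real_polynomial_function.intros(4)[OF snd_poly fst_poly[OF f'_poly[OF 2(2)]]]]
            by (simp add: inner_diff_left)
        qed
      qed
      then show ?thesis by (simp add: polynomial_function_iff_Basis_inner)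
    qed
    have quad_poly: "real_polynomial_function (\<lambda>z. quadratic (fst z) (snd z))"
      unfolding quadratic_def
      by (intro real_polynomial_function.intros(2-4) real_polynomial_function_diff
          real_polynomial_function_power fst_poly snd_poly
          real_polynomial_function_inner_gradient f)
    have quad_nonzero: "quadratic (fst (0, 0)) (snd (0, 0)) \<noteq> 0"
      by (simp add: quadratic_def)
    \<comment> \<open>Here the denominator is 1, and the pairs (x, w) and the pairs (c, t) both
      range over \<open>'a \<times> real\<close>, so the dimensions are equal.\<close>
    obtain Q where Q: "real_polynomial_function Q" "\<exists>y. Q y \<noteq> 0"
      "\<And>z. quadratic (fst z) (snd z) = 0 \<Longrightarrow>
        Q (fst z - snd z *\<^sub>R f' (fst z), fst z \<bullet> b) = 0"
      using image_of_hypersurface_algebraic[OF param_poly real_polynomial_function.intros(2)[of 1]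
          quad_poly quad_nonzero] by auto
    have "Q z = 0" if "z \<in> T b" for z
      using that Q(3) unfolding T_def by fastforce
    then show "\<exists>R D. sep b R D"
      unfolding sep_def by (rule separable_annihilator[OF Q(1,2)])
  qed
  then obtain R where "\<forall>b\<in>Basis. \<exists>D. sep b (R b) D"
    using bchoice[of Basis "\<lambda>b R. \<exists>D. sep b R D"] by blast
  then obtain D where RD: "\<And>b. b \<in> Basis \<Longrightarrow> sep b (R b) (D b)"
    using bchoice[of Basis "\<lambda>b D. sep b (R b) D"] by blast
  \<comment> \<open>\<open>E0\<close> rules out double roots w; each \<open>D b\<close> makes the
    relation for the coordinate \<open>b\<close> nonzero with simple roots only.\<close>
  define P where "P = E0 * (\<Prod>b\<in>Basis. D b)"
  have "P \<noteq> 0"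
    unfolding P_def using RD D0(2) E0 by (auto simp: sep_def polyfun_nonzero_iff[of E0])
  have P_nonzero: "D0 c \<noteq> 0" "\<And>b. b \<in> Basis \<Longrightarrow> eval_polyfun (D b) c \<noteq> 0"
    if "eval_polyfun P c \<noteq> 0" for c
    using that by (auto simp: P_def E0)
  have crit_quadratic: "quadratic x (multiplier c x) = 0" "x - multiplier c x *\<^sub>R f' x = c"
    if "f x \<noteq> 0" "critical_field c x = 0" for c x
    using quadratic_multiplier[OF that(1), of c] multiplier_scaleR[OF that(1), of c] that(2) by auto
  show thesis
  proof
    show "real_polynomial_function (eval_polyfun P)" ..
    show "\<exists>y. eval_polyfun P y \<noteq> 0"
      using \<open>P \<noteq> 0\<close> by (simp add: polyfun_nonzero_iff)
    fix c assume Pc: "eval_polyfun P c \<noteq> 0"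
    let ?Z = "{x. f x \<noteq> 0 \<and> critical_field c x = 0}"
    have roots: "poly (specialize (R b) c) (x \<bullet> b) = 0" if "x \<in> ?Z" "b \<in> Basis" for x b
    proof -
      have "(c, x \<bullet> b) \<in> T b"
        unfolding T_def using that crit_quadratic[of x c]
        by (intro CollectI exI[of _ x] exI[of _ "multiplier c x"]) auto
      then show ?thesis
        using RD[OF that(2)] by (auto simp: sep_def)
    qed
    show "finite ?Z"
    proof (rule finite_subset)
      let ?B = "PiE Basis (\<lambda>b. {t. poly (specialize (R b) c) t = 0})"
      show "?Z \<subseteq> (\<lambda>y. \<Sum>b\<in>Basis. y b *\<^sub>R b) ` ?B"
      proof
        fix x assume x: "x \<in> ?Z"
        show "x \<in> (\<lambda>y. \<Sum>b\<in>Basis. y b *\<^sub>R b) ` ?B"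
        proof (rule image_eqI)
          show "x = (\<Sum>b\<in>Basis. restrict (\<lambda>b. x \<bullet> b) Basis b *\<^sub>R b)"
            by (simp add: euclidean_representation)
          show "restrict (\<lambda>b. x \<bullet> b) Basis \<in> ?B"
            using roots[OF x] by auto
        qed
      qed
      show "finite ((\<lambda>y. \<Sum>b\<in>Basis. y b *\<^sub>R b) ` ?B)"
        using P_nonzero(2)[OF Pc] RD unfolding sep_def
        by (intro finite_imageI finite_PiE poly_roots_finite) auto
    qed
    fix x L \<omega>
    assume fx: "f x \<noteq> 0" and crit: "critical_field c x = 0"
      and L: "(critical_field c has_derivative L) (at x)" "L \<omega> = 0"
    have simple: "k * f x * multiplier c x \<noteq> 2"
    proof
      assume double: "k * f x * multiplier c x = 2"
      have kf: "k * f x \<noteq> 0" using fx k by simp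
      then have m: "multiplier c x = 2 / (k * f x)"
        using double by (simp add: field_simps)
      have "discriminant x = 0"
        using crit_quadratic(1)[OF fx crit] kf unfolding m quadratic_def discriminant_def
        by (simp add: field_simps power2_eq_square)
      moreover have "((k * f x) *\<^sub>R x - 2 *\<^sub>R f' x) /\<^sub>R (k * f x) = c"
      proof -
        have "(k * f x) *\<^sub>R x - 2 *\<^sub>R f' x = (k * f x) *\<^sub>R (x - (2 / (k * f x)) *\<^sub>R f' x)"
          using kf by (simp add: scaleR_diff_right)
        also have "\<dots> = (k * f x) *\<^sub>R c"
          using crit_quadratic(2)[OF fx crit] by (simp add: m)
        also have "\<dots> /\<^sub>R (k * f x) = c"
          using kf by (metis left_inverse scaleR_one scaleR_scaleR)
        finally show ?thesis .
      qed
      ultimately show False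
        using D0(3)[OF kf] P_nonzero(1)[OF Pc] by simp
    qed
    obtain \<gamma> where \<gamma>: "\<gamma> 0 = c" "(\<gamma> has_vector_derivative 0) (at 0)"
      "\<forall>\<^sub>F s in nhds 0. \<exists>v. quadratic (x + s *\<^sub>R \<omega>) v = 0 \<and>
        \<gamma> s = (x + s *\<^sub>R \<omega>) - v *\<^sub>R f' (x + s *\<^sub>R \<omega>)"
      using critical_field_differentiable_imp_first_order[OF fx crit L simple] by blast
    have "\<omega> \<bullet> b = 0" if b: "b \<in> Basis" for b
    proof -
      have t: "((\<lambda>s. (x + s *\<^sub>R \<omega>) \<bullet> b) has_real_derivative \<omega> \<bullet> b) (at 0)"
        by (simp add: inner_add_left) (auto intro!: derivative_eq_intros)
      have ev: "\<forall>\<^sub>F s in nhds 0. poly (specialize (R b) (\<gamma> s)) ((x + s *\<^sub>R \<omega>) \<bullet> b) = 0"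
        using \<gamma>(3)
      proof eventually_elim
        case (elim s)
        then have "(\<gamma> s, (x + s *\<^sub>R \<omega>) \<bullet> b) \<in> T b"
          by (auto simp: T_def)
        then show ?case
          using RD[OF b] by (auto simp: sep_def)
      qed
      have "((\<lambda>s. poly (specialize (R b) (\<gamma> s)) ((x + s *\<^sub>R \<omega>) \<bullet> b)) has_real_derivative 0) (at 0)"
        by (rule iffD2[OF DERIV_cong_ev[OF refl ev refl] DERIV_const])
      then have "poly (pderiv (specialize (R b) c)) (x \<bullet> b) * (\<omega> \<bullet> b) = 0"
        using DERIV_unique[OF specialize_has_derivative_along_curve[OF \<gamma>(2) t, of "R b"]] \<gamma>(1)
        by simp
      moreover have "poly (pderiv (specialize (R b) c)) (x \<bullet> b) \<noteq> 0"
        using RD[OF b] P_nonzero(2)[OF Pc b] roots[OF _ b] fx crit by (simp add: sep_def)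
      ultimately show ?thesis by simp
    qed
    then show "\<omega> = 0" by (rule euclidean_all_zero_iff[THEN iffD1, rule_format])
  qed
qed

end

section \<open>Growth, coefficients and dimension\<close>

lemma poly_degree_le_growth:
  assumes "poly_degree_le k p"
  shows "\<exists>C\<ge>0. \<forall>x. \<bar>p x\<bar> \<le> C * (1 + norm x) ^ k"
  using assms
proof (induction rule: poly_degree_le.induct)
  case (const k c)
  have "\<bar>c\<bar> * 1 \<le> \<bar>c\<bar> * (1 + norm x) ^ k" for x :: 'a
    by (intro mult_left_mono one_le_power) auto
  then show ?case by (intro exI[of _ "\<bar>c\<bar>"]) auto
next
  case (linear l k)
  obtain B where B: "B > 0" "\<And>x. norm (l x) \<le> norm x * B"
    using bounded_linear.pos_bounded[OF linear] by blast
  have "\<bar>l x\<bar> \<le> B * (1 + norm x) ^ Suc k" for x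
  proof -
    have "\<bar>l x\<bar> \<le> B * (1 + norm x)"
      using B(2)[of x] B(1) by (simp add: algebra_simps)
    also have "\<dots> \<le> B * (1 + norm x) ^ Suc k"
      using B(1) self_le_power[of "1 + norm x" "Suc k"] by (intro mult_left_mono) auto
    finally show ?thesis .
  qed
  then show ?case using B(1) by (intro exI[of _ B]) auto
next
  case (add k p q)
  then obtain C D where C: "C \<ge> 0" "\<And>x. \<bar>p x\<bar> \<le> C * (1 + norm x) ^ k"
    and D: "D \<ge> 0" "\<And>x. \<bar>q x\<bar> \<le> D * (1 + norm x) ^ k" by blast
  have "\<bar>p x + q x\<bar> \<le> (C + D) * (1 + norm x) ^ k" for x
    using C(2)[of x] D(2)[of x] abs_triangle_ineq[of "p x" "q x"] by (simp add: algebra_simps)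
  then show ?case using C(1) D(1) by (intro exI[of _ "C + D"]) auto
next
  case (mult j p k q l)
  then obtain C D where C: "C \<ge> 0" "\<And>x. \<bar>p x\<bar> \<le> C * (1 + norm x) ^ j"
    and D: "D \<ge> 0" "\<And>x. \<bar>q x\<bar> \<le> D * (1 + norm x) ^ k" by blast
  have "\<bar>p x * q x\<bar> \<le> (C * D) * (1 + norm x) ^ l" for x
  proof -
    have "\<bar>p x * q x\<bar> \<le> (C * (1 + norm x) ^ j) * (D * (1 + norm x) ^ k)"
      unfolding abs_mult using C D by (intro mult_mono) auto
    also have "\<dots> = (C * D) * (1 + norm x) ^ (j + k)"
      by (simp add: power_add)
    also have "\<dots> \<le> (C * D) * (1 + norm x) ^ l"
      using mult.hyps C(1) D(1) by (intro mult_left_mono power_increasing) auto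
    finally show ?thesis .
  qed
  then show ?case using C(1) D(1) by (intro exI[of _ "C * D"]) auto
qed

text \<open>The clause for \<open>k = 0\<close> compensates for truncated subtraction: in a product
  with a factor of degree bound 0, the corresponding term of the product rule must be absent for the
  bound to drop by one.\<close>

lemma poly_degree_le_has_gradient:
  fixes p :: "'a::euclidean_space \<Rightarrow> real"
  assumes "poly_degree_le k p"
  shows "\<exists>p'. (k = 0 \<longrightarrow> p' = (\<lambda>_. 0)) \<and> (\<forall>b. poly_degree_le (k - 1) (\<lambda>x. p' x \<bullet> b)) \<and>
    (\<forall>x. (p has_derivative (\<lambda>h. p' x \<bullet> h)) (at x))"
  using assms
proof (induction rule: poly_degree_le.induct)
  case (const k c)
  show ?case by (intro exI[of _ "\<lambda>_. 0"]) (auto intro: poly_degree_le.const)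
next
  case (linear l k)
  define v where "v = (\<Sum>b\<in>Basis. l b *\<^sub>R b)"
  have "l h = v \<bullet> h" for h
  proof -
    have "l h = l (\<Sum>b\<in>Basis. (h \<bullet> b) *\<^sub>R b)"
      by (simp add: euclidean_representation)
    also have "\<dots> = (\<Sum>b\<in>Basis. (h \<bullet> b) * l b)"
      using bounded_linear.linear[OF linear] by (simp only: linear_sum linear_cmul real_scaleR_def)
    also have "\<dots> = v \<bullet> h"
      by (simp add: v_def inner_sum_left inner_commute[of h] mult.commute)
    finally show ?thesis .
  qed
  then have "(l has_derivative (\<lambda>h. v \<bullet> h)) (at x)" for x
    using bounded_linear_imp_has_derivative[OF linear] by (metis (no_types, lifting) ext)
  then show ?case
    by (intro exI[of _ "\<lambda>_. v"]) (auto intro: poly_degree_le.const)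
next
  case (add k p q)
  then obtain p' q' where
    p': "k = 0 \<longrightarrow> p' = (\<lambda>_. 0)" "\<And>b. poly_degree_le (k - 1) (\<lambda>x. p' x \<bullet> b)"
      "\<And>x. (p has_derivative (\<lambda>h. p' x \<bullet> h)) (at x)" and
    q': "k = 0 \<longrightarrow> q' = (\<lambda>_. 0)" "\<And>b. poly_degree_le (k - 1) (\<lambda>x. q' x \<bullet> b)"
      "\<And>x. (q has_derivative (\<lambda>h. q' x \<bullet> h)) (at x)"
    by blast
  show ?case
  proof (intro exI[of _ "\<lambda>x. p' x + q' x"] conjI allI impI)
    show "(\<lambda>x. p' x + q' x) = (\<lambda>_. 0)" if "k = 0" using p'(1) q'(1) that by simp
    show "poly_degree_le (k - 1) (\<lambda>x. (p' x + q' x) \<bullet> b)" for b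
      unfolding inner_add_left using p'(2) q'(2) by (rule poly_degree_le.add)
    show "((\<lambda>x. p x + q x) has_derivative (\<lambda>h. (p' x + q' x) \<bullet> h)) (at x)" for x
      unfolding inner_add_left using p'(3) q'(3) by (rule has_derivative_add)
  qed
next
  case (mult j p k q l)
  then obtain p' q' where
    p': "j = 0 \<longrightarrow> p' = (\<lambda>_. 0)" "\<And>b. poly_degree_le (j - 1) (\<lambda>x. p' x \<bullet> b)"
      "\<And>x. (p has_derivative (\<lambda>h. p' x \<bullet> h)) (at x)" and
    q': "k = 0 \<longrightarrow> q' = (\<lambda>_. 0)" "\<And>b. poly_degree_le (k - 1) (\<lambda>x. q' x \<bullet> b)"
      "\<And>x. (q has_derivative (\<lambda>h. q' x \<bullet> h)) (at x)"
    by blast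
  show ?case
  proof (intro exI[of _ "\<lambda>x. p x *\<^sub>R q' x + q x *\<^sub>R p' x"] conjI allI impI)
    show "(\<lambda>x. p x *\<^sub>R q' x + q x *\<^sub>R p' x) = (\<lambda>_. 0)" if "l = 0"
      using p'(1) q'(1) that mult.hyps by simp
    have 1: "poly_degree_le (l - 1) (\<lambda>x. p x * (q' x \<bullet> b))" for b
    proof (cases "k = 0")
      case True
      then show ?thesis using q'(1) by (simp add: poly_degree_le.const)
    next
      case False
      then show ?thesis
        using mult.hyps by (intro poly_degree_le.mult[of j _ "k - 1"] q'(2)) auto
    qed
    have 2: "poly_degree_le (l - 1) (\<lambda>x. q x * (p' x \<bullet> b))" for b
    proof (cases "j = 0")
      case True
      then show ?thesis using p'(1) by (simp add: poly_degree_le.const)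
    next
      case False
      then show ?thesis
        using mult.hyps by (intro poly_degree_le.mult[of k _ "j - 1"] p'(2)) auto
    qed
    show "poly_degree_le (l - 1) (\<lambda>x. (p x *\<^sub>R q' x + q x *\<^sub>R p' x) \<bullet> b)" for b
      unfolding inner_add_left inner_scaleR_left using 1 2 by (rule poly_degree_le.add)
    show "((\<lambda>x. p x * q x) has_derivative (\<lambda>h. (p x *\<^sub>R q' x + q x *\<^sub>R p' x) \<bullet> h)) (at x)" for x
      using has_derivative_mult[OF p'(3) q'(3)] by (simp add: inner_add_left mult.commute)
  qed
qed

lemma poly_degree_le_nth: "poly_degree_le (Suc k) (\<lambda>x. x $ i)"
  by (intro poly_degree_le.linear bounded_linear_vec_nth)

lemma poly_degree_le_eval_mpoly: "poly_degree_le (total_degree f) (eval_mpoly f)"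
proof -
  have "poly_degree_le (total_degree f)
      (\<lambda>x. Poly_Mapping.lookup f m * (\<Prod>i\<in>UNIV. (x $ i) ^ Poly_Mapping.lookup m i))"
    if m: "m \<in> Poly_Mapping.keys f" for m
  proof (rule poly_degree_le.mult[OF poly_degree_le.const[of 0]])
    have "poly_degree_le (Poly_Mapping.lookup m i) (\<lambda>x. (x $ i) ^ Poly_Mapping.lookup m i)" for i
      using poly_degree_le_power[OF poly_degree_le_nth[of 0 i], of "Poly_Mapping.lookup m i"] by simp
    then show "poly_degree_le (\<Sum>i\<in>UNIV. Poly_Mapping.lookup m i)
        (\<lambda>x. \<Prod>i\<in>UNIV. (x $ i) ^ Poly_Mapping.lookup m i)"
      by (rule poly_degree_le_prod)
    show "0 + (\<Sum>i\<in>UNIV. Poly_Mapping.lookup m i) \<le> total_degree f"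
      unfolding total_degree_def using m by (auto intro!: Max_ge)
  qed
  then have "poly_degree_le (total_degree f) (\<lambda>x. \<Sum>m\<in>Poly_Mapping.keys f.
      Poly_Mapping.lookup f m * (\<Prod>i\<in>UNIV. (x $ i) ^ Poly_Mapping.lookup m i))"
    by (rule poly_degree_le_sum)
  then show ?thesis by (simp only: eval_mpoly_def[symmetric])
qed

section \<open>Coefficient polynomials and polynomial functions\<close>

lemma eval_mpoly_add: "eval_mpoly (p + q) x = eval_mpoly p x + eval_mpoly q x"
proof -
  let ?K = "Poly_Mapping.keys p \<union> Poly_Mapping.keys q"
  have *: "eval_mpoly r x =
      (\<Sum>m\<in>?K. Poly_Mapping.lookup r m * (\<Prod>i\<in>UNIV. (x $ i) ^ Poly_Mapping.lookup m i))"
    if "Poly_Mapping.keys r \<subseteq> ?K" for r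
    unfolding eval_mpoly_def using that
    by (intro sum.mono_neutral_left) (auto simp: in_keys_iff)
  show ?thesis
    by (simp add: *[of p] *[of q] *[of "p + q"] keys_add lookup_add distrib_right sum.distrib)
qed

lemma eval_mpoly_zero: "eval_mpoly 0 x = 0"
  by (simp add: eval_mpoly_def)

lemma eval_mpoly_sum: "eval_mpoly (\<Sum>i\<in>I. p i) x = (\<Sum>i\<in>I. eval_mpoly (p i) x)"
  by (induction I rule: infinite_finite_induct) (auto simp: eval_mpoly_zero eval_mpoly_add)

lemma eval_mpoly_single:
  "eval_mpoly (Poly_Mapping.single m a) x = a * (\<Prod>i\<in>UNIV. (x $ i) ^ Poly_Mapping.lookup m i)"
  by (cases "a = 0") (auto simp: eval_mpoly_def)

lemma real_polynomial_function_imp_eval_mpoly: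
  fixes P :: "real ^ 'n \<Rightarrow> real"
  assumes "real_polynomial_function P"
  shows "\<exists>p. \<forall>x. P x = eval_mpoly p x"
proof -
  obtain k where "box_monomial_sum k P"
    using real_polynomial_function_imp_poly_degree_le[OF assms]
      poly_degree_le_imp_box_monomial_sum by blast
  then obtain a where a:
    "\<And>x. P x = (\<Sum>m\<in>PiE Basis (\<lambda>_. {..k}). a m * (\<Prod>b\<in>Basis. (x \<bullet> b) ^ m b))"
    unfolding box_monomial_sum_def by blast
  have Basis_eq: "(Basis :: (real ^ 'n) set) = range (\<lambda>i. axis i 1)"
    by (auto simp: Basis_vec_def)
  have inj: "inj (\<lambda>i::'n. axis i (1::real))"
    by (auto simp: inj_on_def axis_eq_axis)
  have lookup: "Poly_Mapping.lookup (Abs_poly_mapping m) = m" for m :: "'n \<Rightarrow> nat"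
    by (simp add: Abs_poly_mapping_inverse)
  define p where "p = (\<Sum>m\<in>PiE Basis (\<lambda>_. {..k}).
      Poly_Mapping.single (Abs_poly_mapping (\<lambda>i::'n. m (axis i (1::real)))) (a m))"
  have "P x = eval_mpoly p x" for x
    unfolding a p_def eval_mpoly_sum eval_mpoly_single lookup
    unfolding Basis_eq prod.reindex[OF inj] by (simp add: inner_axis)
  then show ?thesis by blast
qed

text \<open>Extending the coefficients by 0 to a box of exponents reduces this to independence of
  monomials. It serves to find a direction in which the leading form of f does not vanish.\<close>

lemma sum_monomials_nonzero:
  fixes K :: "('n::finite \<Rightarrow>\<^sub>0 nat) set"
  assumes K: "finite K" "m0 \<in> K" "a m0 \<noteq> 0"
  shows "\<exists>y. (\<Sum>m\<in>K. a m * (\<Prod>i\<in>UNIV. y i ^ Poly_Mapping.lookup m i)) \<noteq> (0::real)"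
proof (rule ccontr)
  assume "\<not> ?thesis"
  then have zero: "(\<Sum>m\<in>K. a m * (\<Prod>i\<in>UNIV. y i ^ Poly_Mapping.lookup m i)) = 0" for y :: "'n \<Rightarrow> real"
    by blast
  define D where "D = (\<Sum>m\<in>K. \<Sum>i\<in>UNIV. Poly_Mapping.lookup m i)"
  have D: "Poly_Mapping.lookup m i \<le> D" if "m \<in> K" for m i
  proof -
    have "Poly_Mapping.lookup m i \<le> (\<Sum>i\<in>UNIV. Poly_Mapping.lookup m i)"
      by (rule member_le_sum) auto
    also have "\<dots> \<le> D"
      unfolding D_def using K(1) that by (intro member_le_sum) auto
    finally show ?thesis .
  qed
  define a' where "a' e = (if e \<in> Poly_Mapping.lookup ` K then a (Abs_poly_mapping e) else 0)" for e
  have inj: "inj_on Poly_Mapping.lookup K"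
    by (auto simp: inj_on_def poly_mapping_eqI)
  have vanish: "(\<Sum>e\<in>PiE UNIV (\<lambda>_. {..D}). a' e * (\<Prod>i\<in>UNIV. y i ^ e i)) = 0" for y
  proof -
    have "(\<Sum>e\<in>PiE UNIV (\<lambda>_. {..D}). a' e * (\<Prod>i\<in>UNIV. y i ^ e i)) =
        (\<Sum>e\<in>Poly_Mapping.lookup ` K. a' e * (\<Prod>i\<in>UNIV. y i ^ e i))"
      using D by (intro sum.mono_neutral_right finite_PiE) (auto simp: a'_def)
    also have "\<dots> = (\<Sum>m\<in>K. a m * (\<Prod>i\<in>UNIV. y i ^ Poly_Mapping.lookup m i))"
      by (simp add: sum.reindex[OF inj] a'_def lookup_inverse)
    finally show ?thesis using zero by simp
  qed
  have "Poly_Mapping.lookup m0 \<in> PiE UNIV (\<lambda>_. {..D})"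
    using D[OF K(2)] by auto
  then have "a' (Poly_Mapping.lookup m0) = 0"
    by (rule monomials_independent[OF finite vanish])
  then show False
    using K by (simp add: a'_def lookup_inverse)
qed

text \<open>Otherwise \<open>\<bar>f\<bar>\<close> would be bounded by a multiple of the gradient, whose degree is smaller.\<close>

lemma discriminant_nonzero:
  fixes f :: "('n::finite) mpoly" and f' :: "real ^ 'n \<Rightarrow> real ^ 'n"
  assumes f: "f \<noteq> 0" and k: "k > (0::real)"
    and f': "total_degree f = 0 \<longrightarrow> f' = (\<lambda>_. 0)"
      "\<And>b. poly_degree_le (total_degree f - 1) (\<lambda>x. f' x \<bullet> b)"
  shows "\<exists>x. (k * eval_mpoly f x)\<^sup>2 - 4 * (f' x \<bullet> f' x) \<noteq> 0"
proof (rule ccontr)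
  assume "\<not> ?thesis"
  then have eq: "(k * eval_mpoly f x)\<^sup>2 = 4 * (f' x \<bullet> f' x)" for x
    by auto
  define d where "d = total_degree f"
  define deg where "deg m = (\<Sum>i\<in>UNIV. Poly_Mapping.lookup m i)" for m :: "'n \<Rightarrow>\<^sub>0 nat"
  \<comment> \<open>The monomials of the leading form of f. Along a ray on which this form is
    nonzero, f grows exactly like t^d.\<close>
  define K where "K = {m \<in> Poly_Mapping.keys f. deg m = d}"
  have deg_le: "deg m \<le> d" if "m \<in> Poly_Mapping.keys f" for m
    unfolding d_def total_degree_def deg_def using that by (auto intro!: Max_ge)
  obtain m0 where m0: "m0 \<in> K"
  proof -
    obtain m where m: "m \<in> Poly_Mapping.keys f"
      using f by (metis all_not_in_conv keys_eq_empty)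
    have "d \<in> insert 0 (deg ` Poly_Mapping.keys f)"
      unfolding d_def total_degree_def deg_def by (rule Max_in) auto
    then show thesis
      using that m deg_le[OF m] by (auto simp: K_def)
  qed
  obtain y where y: "(\<Sum>m\<in>K. Poly_Mapping.lookup f m *
      (\<Prod>i\<in>UNIV. y i ^ Poly_Mapping.lookup m i)) \<noteq> 0"
    using sum_monomials_nonzero[of K m0 "Poly_Mapping.lookup f"] m0
    by (auto simp: K_def in_keys_iff)
  define e where "e = (\<chi> i. y i)"
  let ?c = "\<lambda>m. Poly_Mapping.lookup f m * (\<Prod>i\<in>UNIV. y i ^ Poly_Mapping.lookup m i)"
  have expand: "eval_mpoly f (t *\<^sub>R e) = (\<Sum>m\<in>Poly_Mapping.keys f. ?c m * t ^ deg m)" for t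
    unfolding eval_mpoly_def
    by (intro sum.cong refl)
       (simp add: e_def power_mult_distrib prod.distrib deg_def power_sum)
  have lim: "((\<lambda>t. eval_mpoly f (t *\<^sub>R e) * inverse t ^ d) \<longlongrightarrow> (\<Sum>m\<in>K. ?c m)) at_top"
  proof -
    have "((\<lambda>t. \<Sum>m\<in>Poly_Mapping.keys f. ?c m * inverse t ^ (d - deg m)) \<longlongrightarrow>
        (\<Sum>m\<in>Poly_Mapping.keys f. ?c m * 0 ^ (d - deg m))) at_top"
      by (intro tendsto_intros tendsto_inverse_0_at_top filterlim_ident)
    \<comment> \<open>\<open>0 ^ (d - deg m)\<close> is 1 for the monomials of top degree and 0 for
      the others.\<close>
    moreover have "(\<Sum>m\<in>Poly_Mapping.keys f. ?c m * 0 ^ (d - deg m)) = (\<Sum>m\<in>K. ?c m)"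
      using deg_le by (intro sum.mono_neutral_cong_right) (auto simp: K_def le_antisym)
    moreover have "\<forall>\<^sub>F t in at_top. (\<Sum>m\<in>Poly_Mapping.keys f. ?c m * inverse t ^ (d - deg m)) =
        eval_mpoly f (t *\<^sub>R e) * inverse t ^ d"
      using eventually_gt_at_top[of 0]
    proof eventually_elim
      case (elim t)
      show ?case
        unfolding expand sum_distrib_right
      proof (intro sum.cong refl)
        fix m assume "m \<in> Poly_Mapping.keys f"
        then have "inverse t ^ d = inverse t ^ deg m * inverse t ^ (d - deg m)"
          using deg_le by (simp flip: power_add)
        moreover have "t ^ deg m * inverse t ^ deg m = 1"
          using elim by (simp flip: power_mult_distrib)
        ultimately show "?c m * inverse t ^ (d - deg m) = ?c m * t ^ deg m * inverse t ^ d"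
          by (simp add: algebra_simps)
      qed
    qed
    ultimately show ?thesis
      using tendsto_cong by force
  qed
  show False
  proof (cases "d = 0")
    \<comment> \<open>A constant has zero gradient, so the assumed identity would make f
      vanish.\<close>
    case True
    then have "eval_mpoly f x = 0" for x
      using eq[of x] f'(1) k by (simp add: d_def)
    then show False
      using lim y by (simp add: tendsto_const_iff)
  next
    case False
    have "poly_degree_le ((d - 1) + (d - 1)) (\<lambda>x. \<Sum>b\<in>Basis. (f' x \<bullet> b) * (f' x \<bullet> b))"
      using f'(2) unfolding d_def
      by (intro poly_degree_le_sum poly_degree_le.mult[OF _ _ order_refl])
    then have "poly_degree_le (2 * (d - 1)) (\<lambda>x. f' x \<bullet> f' x)"
      by (simp only: euclidean_inner[symmetric] mult_2)
    then obtain C where C: "C \<ge> 0" "\<And>x. \<bar>f' x \<bullet> f' x\<bar> \<le> C * (1 + norm x) ^ (2 * (d - 1))"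
      using poly_degree_le_growth by blast
    \<comment> \<open>The squared gradient is O(t^(2 d - 2)) along the ray, so after division by
      t^(2 d) a factor t^(-2) remains and the limit is 0, against the nonzero leading form.\<close>
    have bound: "\<bar>(k * (eval_mpoly f (t *\<^sub>R e) * inverse t ^ d))\<^sup>2\<bar> \<le>
        4 * C * ((inverse t + norm e) ^ (d - 1) * inverse t)\<^sup>2" if t: "t > 0" for t
    proof -
      have split: "(1 + t * norm e) ^ (d - 1) * inverse t ^ d =
          (inverse t + norm e) ^ (d - 1) * inverse t"
      proof -
        have "inverse t ^ d = inverse t ^ (d - 1) * inverse t"
          using False by (simp add: power_eq_if)
        moreover have "(1 + t * norm e) ^ (d - 1) * inverse t ^ (d - 1) = (inverse t + norm e) ^ (d - 1)"
          using t by (simp add: power_mult_distrib[symmetric] field_simps)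
        ultimately show ?thesis by simp
      qed
      have "(k * (eval_mpoly f (t *\<^sub>R e) * inverse t ^ d))\<^sup>2 =
          (k * eval_mpoly f (t *\<^sub>R e))\<^sup>2 * (inverse t ^ d)\<^sup>2"
        by (simp add: power_mult_distrib)
      also have "\<dots> = 4 * (f' (t *\<^sub>R e) \<bullet> f' (t *\<^sub>R e)) * (inverse t ^ d)\<^sup>2"
        by (simp only: eq)
      also have "\<dots> \<le> 4 * (C * (1 + norm (t *\<^sub>R e)) ^ (2 * (d - 1))) * (inverse t ^ d)\<^sup>2"
        using C(2)[of "t *\<^sub>R e"] by (intro mult_right_mono mult_left_mono) auto
      also have "\<dots> = 4 * C * ((1 + t * norm e) ^ (d - 1) * inverse t ^ d)\<^sup>2"
        using t by (simp add: power_mult_distrib power_even_eq)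
      finally show ?thesis unfolding split by simp
    qed
    have "((\<lambda>t. 4 * C * ((inverse t + norm e) ^ (d - 1) * inverse t)\<^sup>2) \<longlongrightarrow>
        4 * C * ((0 + norm e) ^ (d - 1) * 0)\<^sup>2) at_top"
      by (intro tendsto_intros tendsto_inverse_0_at_top filterlim_ident)
    then have lim0: "((\<lambda>t. 4 * C * ((inverse t + norm e) ^ (d - 1) * inverse t)\<^sup>2) \<longlongrightarrow> 0) at_top"
      by simp
    have "\<forall>\<^sub>F t in at_top. norm ((k * (eval_mpoly f (t *\<^sub>R e) * inverse t ^ d))\<^sup>2) \<le>
        4 * C * ((inverse t + norm e) ^ (d - 1) * inverse t)\<^sup>2"
      using eventually_gt_at_top[of 0] by eventually_elim (simp only: real_norm_def bound)
    then have limit0: "((\<lambda>t. (k * (eval_mpoly f (t *\<^sub>R e) * inverse t ^ d))\<^sup>2) \<longlongrightarrow> 0) at_top"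
      using lim0 by (rule Lim_null_comparison)
    have "((\<lambda>t. (k * (eval_mpoly f (t *\<^sub>R e) * inverse t ^ d))\<^sup>2) \<longlongrightarrow>
        (k * (\<Sum>m\<in>K. ?c m))\<^sup>2) at_top"
      by (intro tendsto_power tendsto_mult tendsto_const lim)
    from tendsto_unique[OF trivial_limit_at_top_linorder this limit0]
    have "(k * (\<Sum>m\<in>K. ?c m))\<^sup>2 = 0" .
    then show False using y k by simp
  qed
qed

text \<open>A cell of full dimension would be a homeomorphic image of the open unit cube, hence open
  by invariance of domain and contained in the empty interior.\<close>

lemma semialg_dim_less_if_interior_empty:
  fixes A :: "(real ^ 'n) set"
  assumes "interior A = {}"
  shows "semialg_dim A < int CARD('n)"
proof -
  let ?dims = "{int (card D) | D C. C \<subseteq> A \<and> semialg_homeomorphic (open_cube (D :: 'n set)) C}"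
  have "finite ?dims"
    by (rule finite_subset[of _ "(\<lambda>D. int (card D)) ` (UNIV :: 'n set set)"]) auto
  moreover have "card D < CARD('n)"
    if C: "C \<subseteq> A" "semialg_homeomorphic (open_cube (D :: 'n set)) C" for D C
  proof (rule ccontr)
    assume "\<not> card D < CARD('n)"
    moreover have "card D \<le> CARD('n)"
      by (intro card_mono) auto
    ultimately have "D = UNIV"
      by (intro card_subset_eq) auto
    then have cube: "open_cube D = box 0 1"
      by (auto simp: open_cube_def mem_box_cart)
    obtain h k where "homeomorphism (open_cube D) C h k"
      using C(2) unfolding semialg_homeomorphic_def by blast
    then have h: "continuous_on (box 0 1) h" "h ` box 0 1 = C" "inj_on h (box 0 1)"
      unfolding cube by (auto simp: homeomorphism_def intro: inj_on_inverseI)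
    have "open C"
      using invariance_of_domain[OF h(1) open_box h(3)] h(2) by simp
    moreover have "(\<chi> i. 1 / 2) \<in> (box 0 1 :: (real ^ 'n) set)"
      by (simp add: mem_box_cart)
    ultimately show False
      using C(1) h(2) assms interior_maximal by blast
  qed
  ultimately show ?thesis
    unfolding semialg_dim_def by (subst Max_less_iff) auto
qed

section \<open>The routing function\<close>

definition shifted_square :: "'a::euclidean_space \<Rightarrow> 'a \<Rightarrow> real" where
  "shifted_square c x = (x - c) \<bullet> (x - c) + 1"

lemma shifted_square_pos: "shifted_square c x > 0"
  unfolding shifted_square_def by (intro add_nonneg_pos) auto

text \<open>Combines 1 + |x| \<le> (1 + |c|) (1 + |x - c|) with (1 + r)^2 \<le> 2 (r^2 + 1). It
  makes a numerator of degree at most 2 m harmless over the m-th power.\<close>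

lemma shifted_square_ge: "(1 + norm x)\<^sup>2 \<le> 2 * (1 + norm c)\<^sup>2 * shifted_square c x"
proof -
  have "norm x \<le> norm (x - c) + norm c"
    by (metis diff_add_cancel norm_triangle_ineq)
  moreover have "(1 + norm c) * (1 + norm (x - c)) = 1 + norm c + norm (x - c) + norm c * norm (x - c)"
    by (simp add: algebra_simps)
  moreover have "0 \<le> norm c * norm (x - c)" by simp
  ultimately have "1 + norm x \<le> (1 + norm c) * (1 + norm (x - c))"
    by linarith
  then have "(1 + norm x)\<^sup>2 \<le> ((1 + norm c) * (1 + norm (x - c)))\<^sup>2"
    by (rule power_mono) simp
  also have "\<dots> = (1 + norm c)\<^sup>2 * (1 + norm (x - c))\<^sup>2"
    by (rule power_mult_distrib)
  also have "\<dots> \<le> (1 + norm c)\<^sup>2 * (2 * shifted_square c x)"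
  proof (rule mult_left_mono)
    have "0 \<le> (1 - norm (x - c))\<^sup>2" by simp
    then show "(1 + norm (x - c))\<^sup>2 \<le> 2 * shifted_square c x"
      unfolding shifted_square_def
      by (simp add: power2_norm_eq_inner[symmetric] power2_sum power2_diff)
  qed simp
  finally show ?thesis by simp
qed

lemma poly_degree_le_inner_self:
  fixes v :: "'a::real_normed_vector \<Rightarrow> 'b::euclidean_space"
  assumes "\<And>b. poly_degree_le k (\<lambda>x. v x \<bullet> b)"
  shows "poly_degree_le (2 * k) (\<lambda>x. v x \<bullet> v x)"
proof -
  have "poly_degree_le (2 * k) (\<lambda>x. \<Sum>b\<in>Basis. (v x \<bullet> b) * (v x \<bullet> b))"
    using assms by (intro poly_degree_le_sum poly_degree_le.mult[of k _ k]) auto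
  then show ?thesis by (simp only: euclidean_inner[symmetric])
qed

lemma poly_degree_le_diff_inner: "poly_degree_le 1 (\<lambda>x. (x - c) \<bullet> b)"
proof -
  have "poly_degree_le 1 (\<lambda>x. x \<bullet> b + - (c \<bullet> b))"
    using poly_degree_le.linear[OF bounded_linear_inner_left, of 0 b]
    by (intro poly_degree_le.add poly_degree_le.const) simp
  then show ?thesis by (simp add: inner_diff_left)
qed

lemma poly_degree_le_shifted_square: "poly_degree_le 2 (shifted_square c)"
  unfolding shifted_square_def
  using poly_degree_le_inner_self[of 1 "\<lambda>x. x - c", OF poly_degree_le_diff_inner]
  by (intro poly_degree_le.add poly_degree_le.const) simp

lemma shifted_square_has_derivative:
  "(shifted_square c has_derivative (\<lambda>h. (2 *\<^sub>R (x - c)) \<bullet> h)) (at x)"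
  unfolding shifted_square_def
  by (auto intro!: derivative_eq_intros simp: inner_commute)

lemma poly_quotient_bounded:
  assumes "poly_degree_le k p" "k \<le> 2 * m"
  shows "\<exists>B. \<forall>x. \<bar>p x / shifted_square c x ^ m\<bar> \<le> B"
proof -
  obtain C where C: "C \<ge> 0" "\<And>x. \<bar>p x\<bar> \<le> C * (1 + norm x) ^ (2 * m)"
    using poly_degree_le_growth[OF poly_degree_le_mono[OF assms]] by blast
  have "\<bar>p x / shifted_square c x ^ m\<bar> \<le> C * (2 * (1 + norm c)\<^sup>2) ^ m" for x
  proof -
    have "\<bar>p x\<bar> \<le> C * ((1 + norm x)\<^sup>2) ^ m"
      using C(2)[of x] by (simp add: power_mult)
    also have "\<dots> \<le> C * (2 * (1 + norm c)\<^sup>2 * shifted_square c x) ^ m"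
      using C(1) shifted_square_ge by (intro mult_left_mono power_mono) auto
    finally have "\<bar>p x\<bar> \<le> C * (2 * (1 + norm c)\<^sup>2) ^ m * shifted_square c x ^ m"
      by (simp add: power_mult_distrib)
    then show ?thesis
      using shifted_square_pos[of c x] by (simp add: abs_divide divide_le_eq)
  qed
  then show ?thesis by blast
qed

text \<open>A factor \<open>shifted_square c x ^ (m - 1)\<close> is cancelled in the quotient rule,
  so the result is again a polynomial over a power of the same denominator and the rule can be
  iterated.\<close>

lemma poly_quotient_has_derivative:
  assumes "(p has_derivative (\<lambda>h. p' \<bullet> h)) (at x)"
  shows "((\<lambda>x. p x / shifted_square c x ^ m) has_derivative
    (\<lambda>h. ((shifted_square c x *\<^sub>R p' - (2 * real m * p x) *\<^sub>R (x - c)) \<bullet> h) /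
      shifted_square c x ^ Suc m)) (at x)"
proof -
  let ?q = "shifted_square c"
  have q: "?q x \<noteq> 0" using shifted_square_pos[of c x] by simp
  let ?q' = "\<lambda>h. real m * ((2 *\<^sub>R (x - c)) \<bullet> h) * ?q x ^ (m - 1)"
  have "((\<lambda>x. p x / ?q x ^ m) has_derivative
      (\<lambda>h. ((p' \<bullet> h) * ?q x ^ m - p x * ?q' h) / (?q x ^ m * ?q x ^ m))) (at x)"
    using q by (intro has_derivative_divide' assms
        has_derivative_power[OF shifted_square_has_derivative]) simp
  moreover have "((p' \<bullet> h) * ?q x ^ m - p x * ?q' h) / (?q x ^ m * ?q x ^ m) =
      ((?q x *\<^sub>R p' - (2 * real m * p x) *\<^sub>R (x - c)) \<bullet> h) / ?q x ^ Suc m" for h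
  proof -
    \<comment> \<open>For \<open>m = 0\<close> the truncated exponent does no harm, as the factor
      \<open>real m\<close> removes the term.\<close>
    have "(v * r ^ m - y * (real m * (2 * u) * r ^ (m - 1))) / (r ^ m * r ^ m) =
        (r * v - 2 * real m * y * u) / r ^ Suc m" if "r \<noteq> 0" for r u v y :: real
      using that by (cases m) (simp_all add: field_simps)
    from this[OF q] show ?thesis
      unfolding inner_diff_left[of "_ *\<^sub>R p'"] inner_scaleR_left .
  qed
  ultimately show ?thesis by simp
qed

text \<open>The two terms have degrees at most 2 + (k - 1) and k + 1; the bound k + 2 covers
  \<open>k = 0\<close> too, where \<open>k - 1\<close> is 0.\<close>

lemma poly_quotient_numerator_degree:
  assumes "poly_degree_le k p" "\<And>b. poly_degree_le (k - 1) (\<lambda>x. p' x \<bullet> b)"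
  shows "poly_degree_le (k + 2)
    (\<lambda>x. (shifted_square c x *\<^sub>R p' x - (2 * real m * p x) *\<^sub>R (x - c)) \<bullet> b)"
proof -
  have 1: "poly_degree_le (k + 2) (\<lambda>x. shifted_square c x * (p' x \<bullet> b))"
    by (rule poly_degree_le.mult[OF poly_degree_le_shifted_square assms(2)]) simp
  have 2: "poly_degree_le (k + 2) (\<lambda>x. (- 2 * real m) * (p x * ((x - c) \<bullet> b)))"
    by (rule poly_degree_le.mult[OF poly_degree_le.const[of 0]
          poly_degree_le.mult[OF assms(1) poly_degree_le_diff_inner order_refl]]) simp
  show ?thesis
    using poly_degree_le.add[OF 1 2]
    by (simp add: inner_diff_left mult.assoc)
qed

lemma gradient_eqI:
  assumes "(g has_derivative (\<lambda>h. v \<bullet> h)) (at x)"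
  shows "gradient g x = v"
  using frechet_derivative_at[OF assms, symmetric]
  by (simp add: gradient_def inner_axis vec_eq_iff)

lemma hessian_eqI:
  assumes "(gradient g has_derivative (\<lambda>h. \<chi> i. v i \<bullet> h)) (at x)"
  shows "hessian g x = (\<chi> i. v i)"
  using frechet_derivative_at[OF assms, symmetric]
  by (simp add: hessian_def matrix_def inner_axis vec_eq_iff)

lemma bounded_range_vec:
  fixes v :: "'a \<Rightarrow> 'b::real_normed_vector ^ 'n"
  assumes "\<And>i. \<exists>B. \<forall>x. norm (v x $ i) \<le> B"
  shows "bounded (range v)"
proof -
  obtain B where B: "\<And>i x. norm (v x $ i) \<le> B i"
    using assms by metis
  have "norm (v x) \<le> (\<Sum>i\<in>UNIV. B i)" for x
  proof -
    have "norm (v x) \<le> (\<Sum>i\<in>UNIV. norm (v x $ i))"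
      unfolding norm_vec_def by (rule L2_set_le_sum) simp
    also have "\<dots> \<le> (\<Sum>i\<in>UNIV. B i)"
      by (rule sum_mono) (rule B)
    finally show ?thesis .
  qed
  then show ?thesis by (auto intro: boundedI)
qed

text \<open>Each differentiation of a polynomial over a power of \<open>shifted_square c\<close> raises the degree of
  the numerator by at most 2 and the exponent by 1, so boundedness at infinity is preserved.\<close>

lemma poly_quotient_derivatives:
  fixes p :: "real ^ 'n \<Rightarrow> real" and c :: "real ^ 'n"
  assumes p: "poly_degree_le k p" and km: "k \<le> 2 * m"
  defines "g \<equiv> \<lambda>x. p x / shifted_square c x ^ m"
  shows "C2 g" "bounded (range (gradient g))" "bounded (range (hessian g))"
    "(gradient g has_derivative (\<lambda>h. hessian g x *v h)) (at x)"
proof -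
  let ?q = "shifted_square c"
  obtain p' where "k = 0 \<longrightarrow> p' = (\<lambda>_. 0)" and p': "\<And>b. poly_degree_le (k - 1) (\<lambda>x. p' x \<bullet> b)"
    "\<And>x. (p has_derivative (\<lambda>h. p' x \<bullet> h)) (at x)"
    using poly_degree_le_has_gradient[OF p] by blast
  define N where "N x = ?q x *\<^sub>R p' x - (2 * real m * p x) *\<^sub>R (x - c)" for x
  have N: "poly_degree_le (k + 2) (\<lambda>x. N x \<bullet> b)" for b
    unfolding N_def by (rule poly_quotient_numerator_degree[OF p p'(1)])
  have N_nth: "poly_degree_le (k + 2) (\<lambda>x. N x $ i)" for i
    using N[of "axis i 1"] by (simp add: inner_axis)
  have g': "(g has_derivative (\<lambda>h. ((1 / ?q x ^ Suc m) *\<^sub>R N x) \<bullet> h)) (at x)" for x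
    using poly_quotient_has_derivative[OF p'(2), where c = c and m = m and x = x]
    by (simp add: g_def N_def)
  have grad: "gradient g x = (\<chi> i. N x $ i / ?q x ^ Suc m)" for x
    using gradient_eqI[OF g', of x] by (simp add: vec_eq_iff)
  have "\<exists>v. (\<forall>b. poly_degree_le (k + 2 - 1) (\<lambda>x. v x \<bullet> b)) \<and>
      (\<forall>x. ((\<lambda>x. N x $ i) has_derivative (\<lambda>h. v x \<bullet> h)) (at x))" for i
    using poly_degree_le_has_gradient[OF N_nth[of i]] by (elim exE conjE) (intro exI conjI)
  from choice[OF allI[OF this]] obtain N' where
    "\<forall>i. (\<forall>b. poly_degree_le (k + 2 - 1) (\<lambda>x. N' i x \<bullet> b)) \<and>
      (\<forall>x. ((\<lambda>x. N x $ i) has_derivative (\<lambda>h. N' i x \<bullet> h)) (at x))" ..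
  then have N': "\<And>i b. poly_degree_le (k + 2 - 1) (\<lambda>x. N' i x \<bullet> b)"
    "\<And>i x. ((\<lambda>x. N x $ i) has_derivative (\<lambda>h. N' i x \<bullet> h)) (at x)"
    by auto
  define H where "H i x = ?q x *\<^sub>R N' i x - (2 * real (Suc m) * N x $ i) *\<^sub>R (x - c)" for i x
  have H: "poly_degree_le (k + 2 + 2) (\<lambda>x. H i x \<bullet> b)" for i b
    unfolding H_def by (rule poly_quotient_numerator_degree[OF N_nth N'(1)])
  have H_nth: "poly_degree_le (k + 2 + 2) (\<lambda>x. H i x $ j)" for i j
    using H[of i "axis j 1"] by (simp add: inner_axis)
  have grad': "(gradient g has_derivative (\<lambda>h. \<chi> i. ((1 / ?q x ^ Suc (Suc m)) *\<^sub>R H i x) \<bullet> h)) (at x)" for x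
  proof -
    have "((\<lambda>x. N x $ i / ?q x ^ Suc m) has_derivative
        (\<lambda>h. ((1 / ?q x ^ Suc (Suc m)) *\<^sub>R H i x) \<bullet> h)) (at x)" for i
      using poly_quotient_has_derivative[OF N'(2), where c = c and m = "Suc m" and x = x]
      by (simp add: H_def)
    then show ?thesis
      unfolding grad[abs_def]
      by (subst has_derivative_componentwise_within)
         (auto simp: Basis_vec_def inner_axis)
  qed
  have hess: "hessian g x = (\<chi> i j. H i x $ j / ?q x ^ Suc (Suc m))" for x
    using hessian_eqI[OF grad', of x] by (simp add: vec_eq_iff)
  show "(gradient g has_derivative (\<lambda>h. hessian g x *v h)) (at x)"
  proof -
    have "(\<chi> i. ((1 / ?q x ^ Suc (Suc m)) *\<^sub>R H i x) \<bullet> h) = hessian g x *v h" for h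
      unfolding hess
      by (simp add: vec_eq_iff matrix_vector_mult_def inner_vec_def sum_divide_distrib)
    then show ?thesis using grad'[of x] by (simp only:)
  qed
  have bound: "\<exists>B. \<forall>x. norm (r x / ?q x ^ l) \<le> B" if "poly_degree_le j r" "j \<le> 2 * l" for r j l
    using poly_quotient_bounded[OF that] by simp
  show "bounded (range (gradient g))"
    unfolding grad using bound[OF N_nth, of "Suc m"] km by (intro bounded_range_vec) simp
  show "bounded (range (hessian g))"
  proof (rule bounded_range_vec)
    fix i
    have "bounded (range (\<lambda>x. hessian g x $ i))"
      unfolding hess using bound[OF H_nth, of "Suc (Suc m)"] km by (intro bounded_range_vec) simp
    then show "\<exists>B. \<forall>x. norm (hessian g x $ i) \<le> B"
      by (auto simp: bounded_iff)
  qed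
  have "continuous_on UNIV (hessian g)"
  proof -
    have cont: "continuous_on UNIV r" if "poly_degree_le j r" for j and r :: "real ^ 'n \<Rightarrow> real"
      using poly_degree_le_imp_real_polynomial_function[OF that]
      by (simp add: continuous_at_imp_continuous_on continuous_real_polymonial_function)
    have "?q x ^ l \<noteq> 0" for x l
      using shifted_square_pos[of c x] by simp
    then show ?thesis
      unfolding hess[abs_def]
      by (intro continuous_on_vec_lambda continuous_on_divide continuous_on_power
          cont[OF H_nth] cont[OF poly_degree_le_shifted_square] ballI)
  qed
  then show "C2 g"
    unfolding C2_def using g' grad' by (auto intro: differentiableI)
qed

lemma invertible_if_kernel_trivial:
  fixes A :: "real ^ 'n ^ 'n"
  assumes "\<And>v. A *v v = 0 \<Longrightarrow> v = 0"
  shows "invertible A"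
  unfolding invertible_left_inverse matrix_left_invertible_ker using assms by blast

theorem theorem36:
  fixes f :: "('n::finite) mpoly"
  assumes "CARD('n) \<ge> 2" and "f \<noteq> 0"
  shows "\<exists>S :: (real ^ 'n) set. semialgebraic S \<and>
           semialg_dim (- S) < int CARD('n) \<and>
           (\<forall>c\<in>S. routing_function
              (\<lambda>x. (eval_mpoly f x)\<^sup>2 /
                   ((\<Sum>i\<in>UNIV. (x $ i - c $ i)\<^sup>2) + 1) ^ (total_degree f + 1)))"
proof -
  define d where "d = total_degree f"
  define k where "k = real (d + 1)"
  let ?f = "eval_mpoly f"
  have deg: "poly_degree_le d ?f"
    unfolding d_def by (rule poly_degree_le_eval_mpoly)
  obtain f' where grad_f: "d = 0 \<longrightarrow> f' = (\<lambda>_. 0)" "\<And>b. poly_degree_le (d - 1) (\<lambda>x. f' x \<bullet> b)"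
    "\<And>x. (?f has_derivative (\<lambda>h. f' x \<bullet> h)) (at x)"
    using poly_degree_le_has_gradient[OF deg] by blast
  interpret polynomial_with_gradient ?f f' k
  proof
    show "polynomial_function f'"
      unfolding polynomial_function_iff_Basis_inner
      using grad_f(2) poly_degree_le_imp_real_polynomial_function by blast
  qed (use deg grad_f(3) poly_degree_le_imp_real_polynomial_function in \<open>auto simp: k_def\<close>)
  obtain x0 where nonzero: "discriminant x0 \<noteq> 0"
    using discriminant_nonzero[OF assms(2) k grad_f(1,2)[unfolded d_def]]
    unfolding discriminant_def by blast
  obtain P where P: "real_polynomial_function P" "\<exists>y. P y \<noteq> 0"
    "\<And>c. P c \<noteq> 0 \<Longrightarrow> finite {x. ?f x \<noteq> 0 \<and> critical_field c x = 0}"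
    "\<And>c x L \<omega>. P c \<noteq> 0 \<Longrightarrow> ?f x \<noteq> 0 \<Longrightarrow> critical_field c x = 0 \<Longrightarrow>
      (critical_field c has_derivative L) (at x) \<Longrightarrow> L \<omega> = 0 \<Longrightarrow> \<omega> = 0"
    by (rule generic_critical_points[OF nonzero]) (rule that)
  define S where "S = {c. P c \<noteq> 0}"
  show ?thesis
  proof (intro exI[of _ S] conjI ballI)
    \<comment> \<open>Squaring turns \<open>P c \<noteq> 0\<close> into a strict inequality, the
      basic form of a semialgebraic set.\<close>
    obtain p where p: "\<And>c. (P c)\<^sup>2 = eval_mpoly p c"
      using real_polynomial_function_imp_eval_mpoly[OF real_polynomial_function_power[OF P(1)]] by metis
    have "S = {c. 0 < eval_mpoly p c}"
      by (simp add: S_def p[symmetric])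
    then show "semialgebraic S"
      by (simp add: semialgebraic.pos)
    have "interior (- S) = {}"
    proof (rule ccontr)
      assume "interior (- S) \<noteq> {}"
      then obtain x where "x \<in> interior (- S)" by blast
      then obtain z where "z \<in> interior (- S)" "P z \<noteq> 0"
        using P(2) real_polynomial_function_nonzero_in_open[OF P(1) _ open_interior] by blast
      then show False
        using interior_subset[of "- S"] by (auto simp: S_def)
    qed
    then show "semialg_dim (- S) < int CARD('n)"
      by (rule semialg_dim_less_if_interior_empty)
    fix c assume "c \<in> S"
    then have Pc: "P c \<noteq> 0" by (simp add: S_def)
    let ?q = "shifted_square c"
    define g where "g = (\<lambda>x. (?f x)\<^sup>2 / ?q x ^ (d + 1))"
    have g_eq: "(\<lambda>x. (?f x)\<^sup>2 / ((\<Sum>i\<in>UNIV. (x $ i - c $ i)\<^sup>2) + 1) ^ (total_degree f + 1)) = g"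
      by (simp add: g_def d_def shifted_square_def inner_vec_def power2_eq_square)
    have deg2: "poly_degree_le (2 * d) (\<lambda>x. (?f x)\<^sup>2)"
      by (rule poly_degree_le_power[OF deg])
    note derivatives = poly_quotient_derivatives[OF deg2, of "d + 1" c, folded g_def]
    have q: "?q x > 0" for x by (rule shifted_square_pos)
    \<comment> \<open>What remains of the gradient of \<open>g\<close> after splitting off
      \<open>critical_field c\<close>; it vanishes only with f, hence at no routing point.\<close>
    define \<mu> where "\<mu> x = 2 * ?f x / ?q x ^ (d + 2)" for x
    have grad: "gradient g x = \<mu> x *\<^sub>R critical_field c x" for x
    proof (rule gradient_eqI)
      have "((\<lambda>x. (?f x)\<^sup>2) has_derivative (\<lambda>h. (2 * ?f x) *\<^sub>R f' x \<bullet> h)) (at x)"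
        using has_derivative_power[OF grad_f(3)[of x], where n = 2] by (simp add: mult.commute mult.left_commute)
      note quotient = poly_quotient_has_derivative[OF this, of c "d + 1"]
      have "?q x *\<^sub>R ((2 * ?f x) *\<^sub>R f' x) - (2 * real (d + 1) * (?f x)\<^sup>2) *\<^sub>R (x - c) =
          (2 * ?f x) *\<^sub>R critical_field c x"
        unfolding critical_field_def shifted_square_def scaleR_diff_right[of "2 * ?f x"]
        by (simp add: k_def power2_eq_square mult_ac)
      then show "(g has_derivative (\<lambda>h. \<mu> x *\<^sub>R critical_field c x \<bullet> h)) (at x)"
        using quotient by (simp add: g_def \<mu>_def)
    qed
    have routing_iff: "routing_point g x \<longleftrightarrow> ?f x \<noteq> 0 \<and> critical_field c x = 0" for x
    proof -
      have "g x \<noteq> 0 \<longleftrightarrow> ?f x \<noteq> 0" "\<mu> x = 0 \<longleftrightarrow> ?f x = 0"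
        using q[of x] by (auto simp: g_def \<mu>_def)
      then show ?thesis by (auto simp: routing_point_def grad)
    qed
    have nondegenerate: "invertible (hessian g x)" if x: "routing_point g x" for x
    proof (rule invertible_if_kernel_trivial)
      fix \<omega> assume \<omega>: "hessian g x *v \<omega> = 0"
      have fx: "?f x \<noteq> 0" and crit: "critical_field c x = 0"
        using x routing_iff by auto
      obtain F' where F': "(f' has_derivative F') (at x)"
        using differentiable_at_polynomial_function[OF f'] unfolding differentiable_def by blast
      obtain L where L: "(critical_field c has_derivative L) (at x)"
      proof
        show "(critical_field c has_derivative
            (\<lambda>h. ?q x *\<^sub>R F' h + ((2 *\<^sub>R (x - c)) \<bullet> h) *\<^sub>R f' x -
              ((k * ?f x) *\<^sub>R h + (k * (f' x \<bullet> h)) *\<^sub>R (x - c)))) (at x)"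
          unfolding critical_field_def shifted_square_def[symmetric]
          by (intro has_derivative_diff has_derivative_scaleR has_derivative_mult_right
              shifted_square_has_derivative F' grad_f(3))
             (auto intro!: derivative_eq_intros)
      qed
      have "((\<lambda>x. 2 * ?f x) has_derivative (\<lambda>h. (2 *\<^sub>R f' x) \<bullet> h)) (at x)"
        using has_derivative_mult_right[OF grad_f(3)[of x], of 2] by simp
      from poly_quotient_has_derivative[OF this, of c "d + 2"]
      obtain M where M: "(\<mu> has_derivative M) (at x)"
        unfolding \<mu>_def by blast
      \<comment> \<open>At a routing point the second term is zero, so the Hessian is the nonzero
        multiple \<open>\<mu> x\<close> of the derivative \<open>L\<close> of the critical field and
        has the same kernel.\<close>
      have "(gradient g has_derivative (\<lambda>h. \<mu> x *\<^sub>R L h + M h *\<^sub>R critical_field c x)) (at x)"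
        unfolding grad[abs_def] by (rule has_derivative_scaleR[OF M L])
      then have "(\<lambda>h. hessian g x *v h) = (\<lambda>h. \<mu> x *\<^sub>R L h)"
        using has_derivative_unique[OF derivatives(4)[of x]] crit by simp
      then have "\<mu> x *\<^sub>R L \<omega> = 0"
        using \<omega> by metis
      then have "L \<omega> = 0"
        using fx q[of x] by (simp add: \<mu>_def)
      then show "\<omega> = 0"
        using P(4)[OF Pc fx crit L] by blast
    qed
    have vanishing: "\<exists>\<delta>>0. \<forall>x. norm x \<ge> \<delta> \<longrightarrow> g x \<le> \<epsilon>" if \<epsilon>: "\<epsilon> > 0" for \<epsilon>
    proof -
      \<comment> \<open>The exponent deg f + 1 is one more than boundedness requires; the additional
        factor 1 / \<open>?q x\<close> gives decay at infinity.\<close>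
      obtain B where B: "\<And>x. \<bar>(?f x)\<^sup>2 / ?q x ^ d\<bar> \<le> B"
        using poly_quotient_bounded[OF deg2 order_refl] by blast
      have "B \<ge> 0" using B[of 0] by linarith
      define K where "K = 2 * (1 + norm c)\<^sup>2"
      have "1 + norm c > 0" by (intro add_pos_nonneg) auto
      then have K: "K > 0" by (simp add: K_def)
      \<comment> \<open>Read off from B K / \<epsilon> \<le> 1 + |x| \<le> (1 + |x|)^2 \<le> K
        \<open>?q x\<close>; the summand 1 keeps it positive.\<close>
      define \<delta> where "\<delta> = B * K / \<epsilon> + 1"
      have "\<delta> > 0"
        using \<open>B \<ge> 0\<close> K \<epsilon> by (auto simp: \<delta>_def intro!: add_nonneg_pos)
      moreover have "g x \<le> \<epsilon>" if x: "norm x \<ge> \<delta>" for x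
      proof -
        have "B * K / \<epsilon> \<le> 1 + norm x"
          using x by (simp add: \<delta>_def)
        also have "\<dots> \<le> (1 + norm x)\<^sup>2"
          using self_le_power[of "1 + norm x" 2] by simp
        also have "\<dots> \<le> K * ?q x"
          unfolding K_def by (rule shifted_square_ge)
        finally have "B / ?q x \<le> \<epsilon>"
          using K \<epsilon> q[of x] by (simp add: field_simps)
        moreover have "g x = ((?f x)\<^sup>2 / ?q x ^ d) / ?q x"
          by (simp add: g_def mult.commute)
        moreover have "(?f x)\<^sup>2 / ?q x ^ d \<le> B"
          by (rule abs_le_D1[OF B])
        ultimately show ?thesis
          using divide_right_mono[of "(?f x)\<^sup>2 / ?q x ^ d" B "?q x"] q[of x] by simp
      qed
      ultimately show ?thesis by blast
    qed
    have "finite {x. routing_point g x}"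
      using P(3)[OF Pc] by (simp only: routing_iff)
    moreover have "g x \<ge> 0" for x
      using q[of x] by (simp add: g_def)
    ultimately show "routing_function (\<lambda>x. (?f x)\<^sup>2 /
        ((\<Sum>i\<in>UNIV. (x $ i - c $ i)\<^sup>2) + 1) ^ (total_degree f + 1))"
      unfolding g_eq routing_function_def
      using derivatives(1-3) vanishing nondegenerate by simp
  qed
qed

end
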